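(* Let $M$ be a graphic or cographic matroid whose ground set has at least two elements. Then $$\beta(M)\,\mathrm{rk}(M) = (-1)^{\mathrm{rk}(M)}\sum_{A\subseteq M} (-1)^{|A|}\, c(A).$$
   Context: All matroids and graphs are finite; graphs are undirected and may have multiple edges and self-loops. The sum runs over all subsets $A$ of the ground set of $M$; $\mathrm{rk}(A)$ is the rank of $A$ in $M$. Crapo's invariant of a matroid is $\beta(M)=(-1)^{\mathrm{rk}(M)}\sum_{A\subseteq M}(-1)^{|A|}\,\mathrm{rk}(A)\in\mathbb{Z}$. For a matroid $N$, $c(N)$ is the number of connected components of $N$, i.e. the largest $k$ such that $N=N_1\oplus\cdots\oplus N_k$ with all $N_i$ non-empty matroids (each loop and each coloop is a component by itself; $c$ of the empty matroid is $0$). For a subset $A$, $c(A)$ means $c(M|A)$, where $M|A$ is the restriction. A matroid is graphic if it is isomorphic to the cycle matroid of a graph, and cographic if its dual is graphic. *)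

theory Defs
  imports Main "HOL-Library.Disjoint_Sets"
begin

section \<open>Matroids\<close>

text \<open>
  The members of \<open>indep_sets\<close> are required to lie inside \<open>ground\<close>, so two matroids on the same
  type are equal as matroids iff the two records are equal.
\<close>

record 'a pre_matroid =
  ground :: "'a set"
  indep_sets :: "'a set set"

locale matroid =
  fixes M :: "'a pre_matroid"
  assumes finite_ground: "finite (ground M)"
    and indep_sets_subset: "indep_sets M \<subseteq> Pow (ground M)"
    and empty_indep: "{} \<in> indep_sets M"
    and indep_mono: "I \<in> indep_sets M \<Longrightarrow> J \<subseteq> I \<Longrightarrow> J \<in> indep_sets M"
    and augmentation: "I \<in> indep_sets M \<Longrightarrow> J \<in> indep_sets M \<Longrightarrow> card I < card J \<Longrightarrow>
      \<exists>x \<in> J - I. insert x I \<in> indep_sets M"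

definition rank_of :: "'a pre_matroid \<Rightarrow> 'a set \<Rightarrow> nat" where
  "rank_of M A = Max (card ` {I \<in> indep_sets M. I \<subseteq> A})"

definition rk :: "'a pre_matroid \<Rightarrow> nat" where
  "rk M = rank_of M (ground M)"

definition basis :: "'a pre_matroid \<Rightarrow> 'a set \<Rightarrow> bool" where
  "basis M B \<longleftrightarrow> B \<in> indep_sets M \<and> (\<forall>I \<in> indep_sets M. B \<subseteq> I \<longrightarrow> I = B)"

text \<open>The bases of the dual are the complements of the bases.\<close>

definition dual :: "'a pre_matroid \<Rightarrow> 'a pre_matroid" where
  "dual M = \<lparr>ground = ground M,
    indep_sets = {I. \<exists>B. basis M B \<and> I \<subseteq> ground M - B}\<rparr>"

text \<open>Only meaningful for subsets of the ground set.\<close>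

definition restriction :: "'a pre_matroid \<Rightarrow> 'a set \<Rightarrow> 'a pre_matroid" where
  "restriction M A = \<lparr>ground = A, indep_sets = {I \<in> indep_sets M. I \<subseteq> A}\<rparr>"

definition matroid_iso :: "'a pre_matroid \<Rightarrow> 'b pre_matroid \<Rightarrow> bool" where
  "matroid_iso M N \<longleftrightarrow> (\<exists>f. bij_betw f (ground M) (ground N) \<and>
    (\<forall>I. I \<subseteq> ground M \<longrightarrow> (I \<in> indep_sets M \<longleftrightarrow> f ` I \<in> indep_sets N)))"

definition crapo_beta :: "'a pre_matroid \<Rightarrow> int" where
  "crapo_beta M = (-1) ^ rk M * (\<Sum>A \<in> Pow (ground M). (-1) ^ card A * int (rank_of M A))"


section \<open>Connected components\<close>

text \<open>
  The internal direct sum \<open>N 0 \<oplus> \<dots> \<oplus> N (k - 1)\<close>, to be used for pairwise disjoint ground sets.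
  For \<open>k = 0\<close> it is the empty matroid.
\<close>

definition direct_sum :: "nat \<Rightarrow> (nat \<Rightarrow> 'a pre_matroid) \<Rightarrow> 'a pre_matroid" where
  "direct_sum k N = \<lparr>ground = (\<Union>i<k. ground (N i)),
    indep_sets = {(\<Union>i<k. I i) | I. \<forall>i<k. I i \<in> indep_sets (N i)}\<rparr>"

definition decomposition :: "'a pre_matroid \<Rightarrow> nat \<Rightarrow> (nat \<Rightarrow> 'a pre_matroid) \<Rightarrow> bool" where
  "decomposition M k N \<longleftrightarrow>
    (\<forall>i<k. matroid (N i) \<and> ground (N i) \<noteq> {}) \<and>
    disjoint_family_on (\<lambda>i. ground (N i)) {..<k} \<and>
    M = direct_sum k N"

definition num_components :: "'a pre_matroid \<Rightarrow> nat" where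
  "num_components M = Max {k. \<exists>N. decomposition M k N}"


section \<open>Graphs and their cycle matroids\<close>

text \<open>
  An edge is mapped to its set of endpoints, which is a singleton for a self-loop; parallel edges
  are distinct edges with the same set of endpoints.
\<close>

record ('v, 'e) pre_multigraph =
  verts :: "'v set"
  edges :: "'e set"
  ends :: "'e \<Rightarrow> 'v set"

locale multigraph =
  fixes G :: "('v, 'e) pre_multigraph"
  assumes finite_verts: "finite (verts G)"
    and finite_edges: "finite (edges G)"
    and ends_subset: "e \<in> edges G \<Longrightarrow> ends G e \<subseteq> verts G"
    and card_ends: "e \<in> edges G \<Longrightarrow> card (ends G e) \<in> {1, 2}"

text \<open>
  A cycle traverses the vertices \<open>vs ! 0, vs ! 1, \<dots>\<close> along the edges \<open>es ! 0, es ! 1, \<dots>\<close>.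
  Length 1 is a self-loop and length 2 a pair of parallel edges.
\<close>

definition is_cycle :: "('v, 'e) pre_multigraph \<Rightarrow> 'v list \<Rightarrow> 'e list \<Rightarrow> bool" where
  "is_cycle G vs es \<longleftrightarrow>
    es \<noteq> [] \<and> length vs = length es \<and> distinct vs \<and> distinct es \<and> set es \<subseteq> edges G \<and>
    (\<forall>i < length es. ends G (es ! i) = {vs ! i, vs ! (Suc i mod length es)})"

definition cycle_matroid :: "('v, 'e) pre_multigraph \<Rightarrow> 'e pre_matroid" where
  "cycle_matroid G = \<lparr>ground = edges G,
    indep_sets = {F. F \<subseteq> edges G \<and> \<not> (\<exists>vs es. is_cycle G vs es \<and> set es \<subseteq> F)}\<rparr>"

text \<open>
  Vertices and edges are taken to be natural numbers because a definition cannot quantify over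
  types. Since graphs are finite this is no restriction, see \<open>graphicI\<close> below.
\<close>

definition graphic :: "'a pre_matroid \<Rightarrow> bool" where
  "graphic M \<longleftrightarrow> (\<exists>G :: (nat, nat) pre_multigraph. multigraph G \<and> matroid_iso M (cycle_matroid G))"

definition cographic :: "'a pre_matroid \<Rightarrow> bool" where
  "cographic M \<longleftrightarrow> graphic (dual M)"

lemma matroid_iso_trans:
  assumes "matroid_iso M N" "matroid_iso N L"
  shows "matroid_iso M L"
proof -
  obtain f where f: "bij_betw f (ground M) (ground N)"
    "\<And>I. I \<subseteq> ground M \<Longrightarrow> I \<in> indep_sets M \<longleftrightarrow> f ` I \<in> indep_sets N"
    using assms(1) unfolding matroid_iso_def by blast
  obtain g where g: "bij_betw g (ground N) (ground L)"
    "\<And>I. I \<subseteq> ground N \<Longrightarrow> I \<in> indep_sets N \<longleftrightarrow> g ` I \<in> indep_sets L"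
    using assms(2) unfolding matroid_iso_def by blast
  have "I \<in> indep_sets M \<longleftrightarrow> (g \<circ> f) ` I \<in> indep_sets L" if "I \<subseteq> ground M" for I
  proof -
    have "f ` I \<subseteq> ground N" using that f(1) by (auto simp: bij_betw_def)
    then show ?thesis using f(2)[OF that] g(2) by (simp add: image_comp)
  qed
  then show ?thesis
    unfolding matroid_iso_def using bij_betw_trans[OF f(1) g(1)] by blast
qed

lemma is_cycle_map:
  assumes "is_cycle G vs es" "multigraph G"
    and "inj_on f (verts G)" "inj_on g (edges G)" "g ` edges G \<subseteq> edges H"
    and ends: "\<And>e. e \<in> edges G \<Longrightarrow> ends H (g e) = f ` ends G e"
  shows "is_cycle H (map f vs) (map g es)"
proof -
  interpret multigraph G by fact
  have c: "es \<noteq> []" "length vs = length es" "distinct vs" "distinct es" "set es \<subseteq> edges G"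
    "\<And>i. i < length es \<Longrightarrow> ends G (es ! i) = {vs ! i, vs ! (Suc i mod length es)}"
    using assms(1) unfolding is_cycle_def by auto
  have "set vs \<subseteq> verts G"
  proof
    fix v assume "v \<in> set vs"
    then obtain i where i: "i < length es" "v = vs ! i"
      using c(2) by (metis in_set_conv_nth)
    then have "es ! i \<in> edges G" using c(5) by auto
    from ends_subset[OF this] c(6)[OF i(1)] i(2) show "v \<in> verts G" by auto
  qed
  then have "distinct (map f vs)" "distinct (map g es)"
    using c assms(3,4) by (auto simp: distinct_map intro: inj_on_subset)
  moreover have "ends H (map g es ! i) = {map f vs ! i, map f vs ! (Suc i mod length es)}"
    if "i < length es" for i
  proof -
    have "es ! i \<in> edges G" using that c(5) by auto
    moreover have "Suc i mod length es < length vs" using c(1,2) by simp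
    ultimately show ?thesis using that c(2) ends c(6)[OF that] by simp
  qed
  moreover have "set (map g es) \<subseteq> edges H"
    using c(5) assms(5) by (auto simp: image_subset_iff)
  ultimately show ?thesis
    unfolding is_cycle_def using c(1,2) by simp
qed

lemma graphicI:
  fixes G :: "('v, 'e) pre_multigraph"
  assumes "multigraph G" "matroid_iso M (cycle_matroid G)"
  shows "graphic M"
proof -
  interpret multigraph G by fact
  obtain f :: "'v \<Rightarrow> nat" where f: "inj_on f (verts G)"
    using finite_imp_inj_to_nat_seg[OF finite_verts] by blast
  obtain g :: "'e \<Rightarrow> nat" where g: "inj_on g (edges G)"
    using finite_imp_inj_to_nat_seg[OF finite_edges] by blast
  let ?g' = "inv_into (edges G) g" and ?f' = "inv_into (verts G) f"
  define H where "H = \<lparr>verts = f ` verts G, edges = g ` edges G,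
    ends = (\<lambda>n. f ` ends G (?g' n))\<rparr>"
  have ends_H: "ends H (g e) = f ` ends G e" if "e \<in> edges G" for e
    using that g by (simp add: H_def)
  have H: "multigraph H"
  proof
    show "finite (verts H)" "finite (edges H)"
      using finite_verts finite_edges by (auto simp: H_def)
  next
    fix n assume "n \<in> edges H"
    then obtain e where e: "e \<in> edges G" "n = g e" by (auto simp: H_def)
    show "ends H n \<subseteq> verts H"
      unfolding e(2) ends_H[OF e(1)] using image_mono[OF ends_subset[OF e(1)]] by (simp add: H_def)
    have "card (ends H n) = card (ends G e)"
      unfolding e(2) ends_H[OF e(1)] by (rule card_image) (meson f inj_on_subset ends_subset e(1))
    then show "card (ends H n) \<in> {1, 2}" using card_ends[OF e(1)] by simp
  qed
  have ends_G: "ends G (?g' n) = ?f' ` ends H n" if "n \<in> edges H" for n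
  proof -
    obtain e where e: "e \<in> edges G" "n = g e" using \<open>n \<in> edges H\<close> by (auto simp: H_def)
    have "?f' ` f ` ends G e = ends G e"
      using ends_subset[OF e(1)] f by (simp add: inv_into_image_cancel)
    then show ?thesis using e ends_H g by simp
  qed
  have inv: "inj_on ?f' (verts H)" "inj_on ?g' (edges H)" "?g' ` edges H \<subseteq> edges G"
    by (auto simp: H_def inj_on_inv_into inv_into_into)
  have "F \<in> indep_sets (cycle_matroid G) \<longleftrightarrow> g ` F \<in> indep_sets (cycle_matroid H)"
    if F: "F \<subseteq> edges G" for F
  proof -
    have "(\<exists>vs es. is_cycle G vs es \<and> set es \<subseteq> F) \<longleftrightarrow>
      (\<exists>vs es. is_cycle H vs es \<and> set es \<subseteq> g ` F)"
    proof safe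
      fix vs es assume *: "is_cycle G vs es" "set es \<subseteq> F"
      have "is_cycle H (map f vs) (map g es)"
        using is_cycle_map[OF *(1) \<open>multigraph G\<close> f g _ ends_H] by (simp add: H_def)
      then show "\<exists>vs es. is_cycle H vs es \<and> set es \<subseteq> g ` F"
        using *(2) by (metis image_mono list.set_map)
    next
      fix vs es assume *: "is_cycle H vs es" "set es \<subseteq> g ` F"
      have "is_cycle G (map ?f' vs) (map ?g' es)"
        using is_cycle_map[OF *(1) H inv ends_G] by simp
      moreover have "set (map ?g' es) \<subseteq> F"
        using *(2) inv_into_image_cancel[OF g F] by auto
      ultimately show "\<exists>vs es. is_cycle G vs es \<and> set es \<subseteq> F" by blast
    qed
    then show ?thesis using F by (auto simp: cycle_matroid_def H_def)
  qed
  then have "matroid_iso (cycle_matroid G) (cycle_matroid H)"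
    unfolding matroid_iso_def using g
    by (intro exI[of _ g]) (auto simp: cycle_matroid_def H_def bij_betw_def)
  then show ?thesis
    unfolding graphic_def using H matroid_iso_trans[OF assms(2)] by blast
qed

end

theory Submission
  imports Defs
begin

text \<open>
  Put \<open>b = (\<Sum>A\<subseteq>E. (-1)^|A| r(A))\<close>, so that \<open>\<beta> = (-1)^rk * b\<close>; the claim is that the alternating
  sum of \<open>c\<close> equals \<open>rk * b\<close>. Both cases follow from one closed formula for the number of blocks of a graph,
  and from the principle that an alternating sum over subsets vanishes as soon as its terms do not
  depend on some element \<open>x\<close>, because \<open>A\<close> and \<open>A \<union> {x}\<close> cancel.
  
  The formula: for a graph with vertex set \<open>V\<close>, rank function \<open>r\<close> and edge set \<open>A\<close>,
  \[ c(A) = \sum_{x \in A} (1 - r(\{x\})) - r(A) + \sum_{v \in V} (r(A) - r(A - \delta(v))), \]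
  where \<open>\<delta>(v)\<close> is the set of edges at \<open>v\<close> (lemma \<open>ncomp_grank\<close>). The right-hand side is additive over direct
  sums. On a single loop it is \<open>1\<close>; on a connected matroid without loops the graph formed by \<open>A\<close>
  and the set \<open>X\<close> of its vertices is connected and stays so when a vertex is deleted, hence the value is
  \<open>-(|X| - 1) + |X| = 1\<close>.
  
  Graphic case (\<open>alternating_sum_ncomp\<close>). Sum the formula over all \<open>A\<close>. The first sum cancels, and so does
  \<open>r(A - \<delta>(v))\<close>, which does not depend on the edges at \<open>v\<close>. What remains is \<open>(|V| - 1) b\<close>. If the graph is
  connected then \<open>|V| - 1 = rk\<close>; otherwise \<open>r\<close> is a sum of two functions of disjoint sets of edges and \<open>b = 0\<close>.
  
  Cographic case (\<open>alternating_sum_ncomp_contract\<close>). A matroid and its dual have the same components, so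
  \<open>c(M|A)\<close> is the number of blocks of \<open>G/B\<close>, where \<open>G\<close> represents the dual and \<open>B = E - A\<close>. Apply the formula
  to \<open>G/B\<close>, whose vertices are the components \<open>C\<close> of \<open>(V, B)\<close>. The loops of \<open>G/B\<close> contribute \<open>|E| b\<close>. The
  vertex \<open>C\<close> contributes \<open>r(E) - (|C| - 1) - r(E[V - C])\<close>; the last term cancels in the alternating sum
  because whether \<open>C\<close> is a component of \<open>B\<close> does not depend on an edge that avoids \<open>C\<close>, and the term is 0
  if there is no such edge. Since the sizes \<open>|C|\<close> add up to \<open>|V|\<close> and the number of components is
  \<open>|V| - r(B)\<close>, the total is \<open>(|E| - r(E)) b\<close>. Here \<open>r\<close> and \<open>b\<close> belong to \<open>G\<close>, and \<open>|E| - r(E)\<close> is the rank of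
  \<open>M\<close>. Passing from the sets \<open>B\<close> back to the sets \<open>A\<close> multiplies the sums for \<open>c\<close> and for the rank by the same sign
  \<open>(-1)^|E|\<close>.
\<close>

section \<open>Alternating sums over subsets\<close>

lemma alternating_sum_split:
  fixes h :: "'a set \<Rightarrow> int"
  assumes "finite E" "x \<in> E"
  shows "(\<Sum>A\<in>Pow E. (-1) ^ card A * h A)
    = (\<Sum>A\<in>Pow (E - {x}). (-1) ^ card A * (h A - h (insert x A)))"
proof -
  have E: "Pow E = Pow (E - {x}) \<union> insert x ` Pow (E - {x})"
    using Pow_insert[of x "E - {x}"] assms(2) by (simp add: insert_absorb)
  have inj: "inj_on (insert x) (Pow (E - {x}))"
    by (auto simp: inj_on_def)
  have "(\<Sum>A\<in>Pow E. (-1) ^ card A * h A) = (\<Sum>A\<in>Pow (E - {x}). (-1) ^ card A * h A)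
      + (\<Sum>A\<in>insert x ` Pow (E - {x}). (-1) ^ card A * h A)"
    unfolding E using assms(1) by (intro sum.union_disjoint) auto
  also have "(\<Sum>A\<in>insert x ` Pow (E - {x}). (-1) ^ card A * h A)
      = (\<Sum>A\<in>Pow (E - {x}). (-1) ^ card (insert x A) * h (insert x A))"
    using inj by (simp add: sum.reindex)
  also have "\<dots> = (\<Sum>A\<in>Pow (E - {x}). - ((-1) ^ card A * h (insert x A)))"
  proof (rule sum.cong[OF refl])
    fix A assume A: "A \<in> Pow (E - {x})"
    then have "finite A" "x \<notin> A" using assms(1) by (auto intro: finite_subset)
    then show "(-1) ^ card (insert x A) * h (insert x A) = - ((-1) ^ card A * h (insert x A))"
      by simp
  qed
  finally show ?thesis
    by (simp add: sum_negf sum_subtractf right_diff_distrib)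
qed

text \<open>
  The cancellation on which everything rests.
\<close>

lemma alternating_sum_eq_0:
  fixes h :: "'a set \<Rightarrow> int"
  assumes "finite E" "x \<in> E" "\<And>A. A \<subseteq> E - {x} \<Longrightarrow> h (insert x A) = h A"
  shows "(\<Sum>A\<in>Pow E. (-1) ^ card A * h A) = 0"
  unfolding alternating_sum_split[OF assms(1,2)] using assms(3) by (intro sum.neutral) auto

lemma alternating_sum_const:
  assumes "finite E" "E \<noteq> {}"
  shows "(\<Sum>A\<in>Pow E. (-1) ^ card A * (c :: int)) = 0"
proof -
  obtain x where "x \<in> E" using assms(2) by blast
  then show ?thesis using assms(1) by (intro alternating_sum_eq_0) auto
qed

lemma alternating_sum_complement:
  fixes h :: "'a set \<Rightarrow> int"
  assumes "finite E"
  shows "(\<Sum>A\<in>Pow E. (-1) ^ card A * h (E - A))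
    = (-1) ^ card E * (\<Sum>B\<in>Pow E. (-1) ^ card B * h B)"
proof -
  have "(\<Sum>A\<in>Pow E. (-1) ^ card A * h (E - A)) = (\<Sum>B\<in>Pow E. (-1) ^ card (E - B) * h B)"
    by (rule sum.reindex_bij_witness[of _ "\<lambda>B. E - B" "\<lambda>B. E - B"]) (auto simp: double_diff)
  also have "\<dots> = (\<Sum>B\<in>Pow E. (-1) ^ card E * ((-1) ^ card B * h B))"
  proof (rule sum.cong[OF refl])
    fix B assume B: "B \<in> Pow E"
    then have "card E = card (E - B) + card B"
      using assms by (metis PowD card_Diff_subset card_mono diff_add finite_subset)
    then have "(-1 :: int) ^ card (E - B) = (-1) ^ card E * (-1) ^ card B"
      by (simp add: power_add flip: power_mult_distrib)
    then show "(-1) ^ card (E - B) * h B = (-1) ^ card E * ((-1) ^ card B * h B)" by simp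
  qed
  finally show ?thesis by (simp add: sum_distrib_left)
qed


section \<open>Rank functions and their separators\<close>

locale rank_function =
  fixes E :: "'a set" and r :: "'a set \<Rightarrow> int"
  assumes finite_E: "finite E"
    and r_empty: "r {} = 0"
    and r_insert_ge: "A \<subseteq> E \<Longrightarrow> x \<in> E \<Longrightarrow> r A \<le> r (insert x A)"
    and r_insert_le: "A \<subseteq> E \<Longrightarrow> x \<in> E \<Longrightarrow> r (insert x A) \<le> r A + 1"
    and submodular: "A \<subseteq> E \<Longrightarrow> B \<subseteq> E \<Longrightarrow> r (A \<union> B) + r (A \<inter> B) \<le> r A + r B"

text \<open>
  Components are counted by partitions into separators, that is, direct summands. A partition is
  a direct sum decomposition iff each of its parts is a separator; phrasing it part by part makes the
  count depend only on which sets are separators, and this relation is unchanged under duality.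
\<close>

definition separator :: "('a set \<Rightarrow> int) \<Rightarrow> 'a set \<Rightarrow> 'a set \<Rightarrow> bool" where
  "separator r A S \<longleftrightarrow> S \<subseteq> A \<and> r S + r (A - S) = r A"

definition separations :: "('a set \<Rightarrow> int) \<Rightarrow> 'a set \<Rightarrow> 'a set set set" where
  "separations r A = {P. partition_on A P \<and> (\<forall>S\<in>P. separator r A S)}"

definition ncomp :: "('a set \<Rightarrow> int) \<Rightarrow> 'a set \<Rightarrow> nat" where
  "ncomp r A = Max (card ` separations r A)"

definition indecomposable :: "('a set \<Rightarrow> int) \<Rightarrow> 'a set \<Rightarrow> bool" where
  "indecomposable r A \<longleftrightarrow> A \<noteq> {} \<and> (\<forall>S. separator r A S \<longrightarrow> S = {} \<or> S = A)"

lemma ncomp_cong: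
  assumes "\<And>S. S \<subseteq> A \<Longrightarrow> separator r A S \<longleftrightarrow> separator s A S"
  shows "ncomp r A = ncomp s A"
proof -
  have "separator r A S \<longleftrightarrow> separator s A S" for S
    using assms by (cases "S \<subseteq> A") (auto simp: separator_def)
  then show ?thesis by (simp add: ncomp_def separations_def)
qed

lemma separator_compl: "separator r A S \<Longrightarrow> separator r A (A - S)"
  by (auto simp: separator_def double_diff)

context rank_function
begin

lemma finite_sub: "A \<subseteq> E \<Longrightarrow> finite A"
  using finite_E finite_subset by blast

lemma r_union_bounds:
  assumes "A \<subseteq> E" "B \<subseteq> E"
  shows "r A \<le> r (A \<union> B) \<and> r (A \<union> B) \<le> r A + int (card B)"
  using finite_sub[OF assms(2)] assms(2)
proof (induction B)
  case (insert x B)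
  have *: "A \<union> B \<subseteq> E" "x \<in> E" using insert.prems assms(1) by auto
  show ?case using r_insert_ge[OF *] r_insert_le[OF *] insert by simp
qed simp

lemma r_mono: "A \<subseteq> B \<Longrightarrow> B \<subseteq> E \<Longrightarrow> r A \<le> r B"
  using r_union_bounds[of A B] by (simp add: Un_absorb1)

lemma r_le_card: "A \<subseteq> E \<Longrightarrow> r A \<le> int (card A)"
  using r_union_bounds[of "{}" A] by (simp add: r_empty)

lemma r_nonneg: "A \<subseteq> E \<Longrightarrow> 0 \<le> r A"
  using r_mono[of "{}" A] by (simp add: r_empty)

lemma subadditive: "A \<subseteq> E \<Longrightarrow> B \<subseteq> E \<Longrightarrow> r (A \<union> B) \<le> r A + r B"
  using submodular[of A B] r_nonneg[of "A \<inter> B"] by (simp add: le_infI1)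

lemma separatorI:
  assumes "S \<subseteq> A" "A \<subseteq> E" "r S + r (A - S) \<le> r A"
  shows "separator r A S"
proof -
  have "S \<union> (A - S) = A" using assms(1) by blast
  moreover have "r (S \<union> (A - S)) \<le> r S + r (A - S)"
    using assms(1,2) by (intro subadditive) auto
  ultimately show ?thesis
    using assms unfolding separator_def by simp
qed

text \<open>
  Both inequalities are submodularity: the harder one follows by adding it for the pairs
  \<open>B, S\<close> and \<open>B \<union> S, A - S\<close>.
\<close>

lemma separator_split:
  assumes "separator r A S" "A \<subseteq> E" "B \<subseteq> A"
  shows "r B = r (B \<inter> S) + r (B - S)"
proof (rule antisym)
  have S: "S \<subseteq> A" "r S + r (A - S) = r A" using assms(1) by (auto simp: separator_def)
  have "r ((B \<inter> S) \<union> (B - S)) \<le> r (B \<inter> S) + r (B - S)"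
    using assms(2,3) by (intro subadditive) auto
  then show "r B \<le> r (B \<inter> S) + r (B - S)" by (simp add: Int_Diff_Un)
  have "r (B \<union> S) + r (B \<inter> S) \<le> r B + r S"
    using S assms by (intro submodular) auto
  moreover have "r ((B \<union> S) \<union> (A - S)) + r ((B \<union> S) \<inter> (A - S)) \<le> r (B \<union> S) + r (A - S)"
    using S assms by (intro submodular) auto
  moreover have "(B \<union> S) \<union> (A - S) = A" "(B \<union> S) \<inter> (A - S) = B - S"
    using S(1) assms(3) by auto
  ultimately show "r (B \<inter> S) + r (B - S) \<le> r B" using S(2) by simp
qed

lemma separator_trans:
  assumes "separator r A S" "separator r S T" "A \<subseteq> E"
  shows "separator r A T"
proof -
  have S: "S \<subseteq> A" "r S + r (A - S) = r A" "T \<subseteq> S" "r T + r (S - T) = r S"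
    using assms by (auto simp: separator_def)
  have "r (A - T) = r ((A - T) \<inter> S) + r (A - T - S)"
    using separator_split[OF assms(1,3)] by blast
  moreover have "(A - T) \<inter> S = S - T" "A - T - S = A - S" using S by auto
  ultimately show ?thesis using S unfolding separator_def by auto
qed

lemma separator_subset:
  assumes "separator r A T" "T \<subseteq> S" "S \<subseteq> A" "A \<subseteq> E"
  shows "separator r S T"
  using separator_split[OF assms(1,4,3)] assms(2) by (simp add: separator_def Int_absorb1)

text \<open>
  A function that is additive over separators and equal to 1 on indecomposable sets counts components:
  splitting repeatedly gives a partition into \<open>f A\<close> indecomposable parts, and no partition into separators
  has more parts because \<open>f\<close> is at least 1 on every non-empty part.
\<close>

lemma ncomp_eqI:
  fixes f :: "'a set \<Rightarrow> int"
  assumes add: "\<And>A S. A \<subseteq> E \<Longrightarrow> separator r A S \<Longrightarrow> f A = f S + f (A - S)"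
    and one: "\<And>A. A \<subseteq> E \<Longrightarrow> indecomposable r A \<Longrightarrow> f A = 1"
    and "A \<subseteq> E"
  shows "int (ncomp r A) = f A"
proof -
  have f_empty: "f {} = 0"
    using add[of "{}" "{}"] by (simp add: separator_def r_empty)
  have ex: "\<exists>P\<in>separations r A. int (card P) = f A" if "A \<subseteq> E" for A
    using finite_sub[OF that] that
  proof (induction A rule: finite_psubset_induct)
    case (psubset A)
    consider "A = {}" | "indecomposable r A"
      | S where "separator r A S" "S \<noteq> {}" "S \<noteq> A"
      unfolding indecomposable_def by blast
    then show ?case
    proof cases
      case 1
      then show ?thesis
        by (intro bexI[of _ "{}"]) (auto simp: separations_def partition_on_def f_empty)
    next
      case 2
      then have "{A} \<in> separations r A"
        by (auto simp: separations_def partition_on_def separator_def indecomposable_def r_empty)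
      then show ?thesis using one[OF psubset.prems 2] by (intro bexI[of _ "{A}"]) auto
    next
      case 3
      have S: "S \<subset> A" "A - S \<subset> A" using 3 by (auto simp: separator_def)
      obtain P where P: "P \<in> separations r S" "int (card P) = f S"
        using psubset.IH[OF S(1)] S psubset.prems by blast
      obtain Q where Q: "Q \<in> separations r (A - S)" "int (card Q) = f (A - S)"
        using psubset.IH[OF S(2)] S psubset.prems by blast
      have parts: "\<Union>P = S" "\<Union>Q = A - S" "{} \<notin> P" "{} \<notin> Q" "disjoint P" "disjoint Q"
        using P(1) Q(1) by (auto simp: separations_def partition_on_def)
      have "finite P" "finite Q"
        using parts(1,2) finite_subset[OF _ psubset.hyps] S by (metis finite_UnionD psubset_imp_subset)+
      moreover have "p = {}" if "p \<in> P" "p \<in> Q" for p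
        using parts(1,2) that by blast
      then have "P \<inter> Q = {}" using parts(3) by blast
      ultimately have "card (P \<union> Q) = card P + card Q" by (rule card_Un_disjoint)
      moreover have "disjoint (P \<union> Q)"
        using parts(1,2,5,6) by (auto intro!: disjoint_union)
      then have "partition_on A (P \<union> Q)"
        using parts S by (auto simp: partition_on_def)
      then have "P \<union> Q \<in> separations r A"
        using P(1) Q(1) separator_trans[OF 3(1) _ psubset.prems]
          separator_trans[OF separator_compl[OF 3(1)] _ psubset.prems]
        by (auto simp: separations_def)
      ultimately show ?thesis
        using add[OF psubset.prems 3(1)] P(2) Q(2) by (intro bexI[of _ "P \<union> Q"]) auto
    qed
  qed
  have pos: "1 \<le> f A" if "A \<subseteq> E" "A \<noteq> {}" for A
  proof -
    obtain P where P: "P \<in> separations r A" "int (card P) = f A" using ex[OF \<open>A \<subseteq> E\<close>] by blast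
    have "\<Union>P = A" using P(1) by (auto simp: separations_def partition_on_def)
    then have "finite P" "P \<noteq> {}"
      using finite_sub[OF \<open>A \<subseteq> E\<close>] \<open>A \<noteq> {}\<close> by (auto intro: finite_UnionD)
    then show ?thesis using P(2) by (metis card_gt_0_iff int_one_le_iff_zero_less of_nat_0_less_iff)
  qed
  have le: "int (card P) \<le> f A" if "finite P" "P \<in> separations r A" "A \<subseteq> E" for P A
    using that
  proof (induction P arbitrary: A)
    case empty
    then show ?case by (auto simp: separations_def partition_on_def f_empty)
  next
    case (insert S P)
    have sep: "separator r A S" "\<And>T. T \<in> P \<Longrightarrow> separator r A T"
      and part: "\<Union>(insert S P) = A" "{} \<notin> insert S P" "disjoint (insert S P)"
      using insert.prems by (auto simp: separations_def partition_on_def)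
    have dis: "S \<inter> T = {}" if "T \<in> P" for T
      using part(3) that insert.hyps(2) by (auto simp: disjoint_def)
    have U: "\<Union>P = A - S" using part(1) dis by auto
    have "separator r (A - S) T" if "T \<in> P" for T
      using separator_subset[OF sep(2)[OF that] _ _ insert.prems(2)] U that by blast
    then have "P \<in> separations r (A - S)"
      using U part by (auto simp: separations_def partition_on_def disjoint_def)
    then have "int (card P) \<le> f (A - S)" using insert by blast
    moreover have "1 \<le> f S" using pos part insert.prems(2) by blast
    ultimately show ?case using add[OF insert.prems(2) sep(1)] insert.hyps by simp
  qed
  have fin: "finite P" if "P \<in> separations r A" for P
    using that finite_sub[OF \<open>A \<subseteq> E\<close>]
    by (auto simp: separations_def partition_on_def intro: finite_UnionD)
  obtain P where P: "P \<in> separations r A" "int (card P) = f A" using ex[OF \<open>A \<subseteq> E\<close>] by blast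
  have "separations r A \<subseteq> Pow (Pow A)"
    by (auto simp: separations_def partition_on_def)
  then have "finite (separations r A)"
    using finite_sub[OF \<open>A \<subseteq> E\<close>] by (meson finite_Pow_iff finite_subset)
  then have "ncomp r A = card P"
    unfolding ncomp_def using P le[OF fin _ \<open>A \<subseteq> E\<close>]
    by (intro Max_eqI) (auto simp: P(2)[symmetric])
  then show ?thesis using P(2) by simp
qed

end


section \<open>Graphic rank\<close>

definition adj :: "('v, 'e) pre_multigraph \<Rightarrow> 'e set \<Rightarrow> ('v \<times> 'v) set" where
  "adj G F = {(a, b). \<exists>x\<in>F. ends G x = {a, b}}"

definition component :: "('v, 'e) pre_multigraph \<Rightarrow> 'e set \<Rightarrow> 'v \<Rightarrow> 'v set" where
  "component G F v = (adj G F)\<^sup>* `` {v}"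

definition components :: "('v, 'e) pre_multigraph \<Rightarrow> 'e set \<Rightarrow> 'v set set" where
  "components G F = component G F ` verts G"

definition grank :: "('v, 'e) pre_multigraph \<Rightarrow> 'e set \<Rightarrow> int" where
  "grank G F = int (card (verts G)) - int (card (components G F))"

lemma sym_adj_rtrancl: "sym ((adj G F)\<^sup>*)"
  by (rule sym_rtrancl) (auto simp: sym_def adj_def insert_commute)

lemma component_self: "v \<in> component G F v"
  by (simp add: component_def)

lemma component_eq_iff: "component G F a = component G F b \<longleftrightarrow> (a, b) \<in> (adj G F)\<^sup>*"
proof
  assume "component G F a = component G F b"
  then have "b \<in> component G F a" using component_self by metis
  then show "(a, b) \<in> (adj G F)\<^sup>*" by (simp add: component_def)
next
  assume *: "(a, b) \<in> (adj G F)\<^sup>*"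
  then have "(b, a) \<in> (adj G F)\<^sup>*" using sym_adj_rtrancl by (metis symD)
  with * show "component G F a = component G F b"
    by (auto simp: component_def intro: rtrancl_trans)
qed

lemma component_eq_iff_mem: "component G F a = component G F b \<longleftrightarrow> b \<in> component G F a"
  unfolding component_eq_iff by (simp add: component_def)

lemma component_mono: "F \<subseteq> F' \<Longrightarrow> component G F v \<subseteq> component G F' v"
  unfolding component_def using rtrancl_mono[of "adj G F" "adj G F'"] by (fastforce simp: adj_def)

lemma component_edge: "x \<in> F \<Longrightarrow> ends G x = {a, b} \<Longrightarrow> component G F a = component G F b"
  unfolding component_eq_iff by (rule r_into_rtrancl) (auto simp: adj_def)

text \<open>
  If no edge of \<open>F\<close> leaves \<open>Y\<close>, then the components meeting \<open>Y\<close> are those of the edges inside \<open>Y\<close>.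
\<close>

lemma component_closed:
  assumes "a \<in> Y" and closed: "\<And>x. x \<in> F \<Longrightarrow> ends G x \<inter> Y \<noteq> {} \<Longrightarrow> ends G x \<subseteq> Y"
  shows "component G F a \<subseteq> Y" and "component G {x \<in> F. ends G x \<subseteq> Y} a = component G F a"
proof -
  have *: "b \<in> Y \<and> (a, b) \<in> (adj G {x \<in> F. ends G x \<subseteq> Y})\<^sup>*" if "(a, b) \<in> (adj G F)\<^sup>*" for b
    using that
  proof (induction rule: rtrancl_induct)
    case base
    then show ?case using assms(1) by simp
  next
    case (step b c)
    then obtain x where x: "x \<in> F" "ends G x = {b, c}" by (auto simp: adj_def)
    then have "ends G x \<subseteq> Y" using closed step.IH by auto
    then have "(b, c) \<in> adj G {x \<in> F. ends G x \<subseteq> Y}" "c \<in> Y" using x by (auto simp: adj_def)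
    then show ?case using step.IH by (auto intro: rtrancl_into_rtrancl)
  qed
  then show "component G F a \<subseteq> Y" by (auto simp: component_def)
  have "component G {x \<in> F. ends G x \<subseteq> Y} a \<subseteq> component G F a"
    by (rule component_mono) auto
  then show "component G {x \<in> F. ends G x \<subseteq> Y} a = component G F a"
    using * by (auto simp: component_def)
qed

context multigraph
begin

lemma ends_pair:
  assumes "x \<in> edges G"
  shows "\<exists>a b. ends G x = {a, b}"
  using card_ends[OF assms] by (force simp: card_1_singleton_iff card_2_iff)

lemma component_absorbs:
  assumes "F \<subseteq> edges G" "x \<in> F" "ends G x \<inter> component G F v \<noteq> {}"
  shows "ends G x \<subseteq> component G F v"
proof -
  obtain a b where ab: "ends G x = {a, b}" using ends_pair assms(1,2) by blast
  then have "component G F a = component G F b" using assms(2) component_edge by metis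
  then have "a \<in> component G F v \<longleftrightarrow> b \<in> component G F v"
    by (metis component_eq_iff_mem)
  then show ?thesis using ab assms(3) by auto
qed

lemma component_subset_verts:
  assumes "F \<subseteq> edges G" "v \<in> verts G"
  shows "component G F v \<subseteq> verts G"
  using assms ends_subset by (intro component_closed(1)) auto

lemma component_insert:
  assumes "insert x F \<subseteq> edges G" "ends G x = {a, b}"
  shows "component G (insert x F) v =
    (if v \<in> component G F a \<union> component G F b then component G F a \<union> component G F b
     else component G F v)"
proof -
  have F: "F \<subseteq> edges G" using assms(1) by simp
  have le: "component G F u \<subseteq> component G (insert x F) u" for u
    by (rule component_mono) auto
  show ?thesis
  proof (cases "v \<in> component G F a \<union> component G F b")
    case True
    have ab: "component G (insert x F) a = component G (insert x F) b"
      using assms(2) by (intro component_edge) auto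
    have v: "component G (insert x F) v = component G (insert x F) a"
      using True le ab by (metis UnE component_eq_iff_mem subsetD)
    have "component G (insert x F) v \<subseteq> component G F a \<union> component G F b"
    proof (rule component_closed(1)[OF True])
      fix y assume y: "y \<in> insert x F" "ends G y \<inter> (component G F a \<union> component G F b) \<noteq> {}"
      show "ends G y \<subseteq> component G F a \<union> component G F b"
      proof (cases "y = x")
        case True
        then show ?thesis using assms(2) component_self[of _ G F] by auto
      next
        case False
        then have "y \<in> F" using y by auto
        then show ?thesis using y(2) component_absorbs[OF F] by blast
      qed
    qed
    moreover have "component G F a \<union> component G F b \<subseteq> component G (insert x F) v"
      using v ab le by auto
    ultimately show ?thesis using True by simp
  next
    case False
    then have "a \<notin> component G F v" "b \<notin> component G F v"
      by (metis UnI1 UnI2 component_eq_iff_mem)+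
    then have "component G (insert x F) v \<subseteq> component G F v"
      using component_absorbs[OF F] assms(2)
      by (intro component_closed(1)[OF component_self]) auto
    then show ?thesis using False le by auto
  qed
qed

lemma finite_components: "finite (components G F)"
  using finite_verts by (simp add: components_def)

lemma grank_insert:
  assumes "insert x F \<subseteq> edges G" "ends G x = {a, b}"
  shows "grank G (insert x F) = grank G F + (if component G F a = component G F b then 0 else 1)"
proof -
  let ?A = "component G F a" and ?B = "component G F b"
  have V: "a \<in> verts G" "b \<in> verts G" using ends_subset[of x] assms by auto
  show ?thesis
  proof (cases "?A = ?B")
    case True
    have "component G (insert x F) v = component G F v" for v
      unfolding component_insert[OF assms] using True component_eq_iff_mem[of G F b v] by auto
    then show ?thesis using True by (simp add: grank_def components_def)
  next
    case False
    have "components G (insert x F) = insert (?A \<union> ?B) (components G F - {?A, ?B})"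
    proof (intro equalityI subsetI)
      fix C assume "C \<in> components G (insert x F)"
      then obtain v where v: "v \<in> verts G" "C = component G (insert x F) v"
        by (auto simp: components_def)
      show "C \<in> insert (?A \<union> ?B) (components G F - {?A, ?B})"
      proof (cases "v \<in> ?A \<union> ?B")
        case True
        then show ?thesis using v(2) component_insert[OF assms, of v] by simp
      next
        case False
        then have C: "C = component G F v" using v(2) component_insert[OF assms, of v] by simp
        then have "v \<in> C" by (simp add: component_self)
        then have "C \<noteq> ?A" "C \<noteq> ?B" using False by auto
        then show ?thesis using C v(1) by (simp add: components_def)
      qed
    next
      fix C assume C: "C \<in> insert (?A \<union> ?B) (components G F - {?A, ?B})"
      show "C \<in> components G (insert x F)"
      proof (cases "C = ?A \<union> ?B")
        case True
        then have "C = component G (insert x F) a"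
          using component_insert[OF assms, of a] by (simp add: component_self)
        then show ?thesis using V by (simp add: components_def)
      next
        case False
        then obtain v where v: "v \<in> verts G" "C = component G F v" "C \<noteq> ?A" "C \<noteq> ?B"
          using C by (auto simp: components_def)
        then have "v \<notin> ?A" "v \<notin> ?B"
          using component_eq_iff_mem[of G F a v] component_eq_iff_mem[of G F b v] by simp_all
        then have "C = component G (insert x F) v"
          using component_insert[OF assms, of v] v(2) by simp
        then show ?thesis using v by (simp add: components_def)
      qed
    qed
    moreover have "?A \<union> ?B \<notin> components G F - {?A, ?B}"
    proof
      assume "?A \<union> ?B \<in> components G F - {?A, ?B}"
      then obtain v where v: "component G F v = ?A \<union> ?B" "component G F v \<noteq> ?A"
        by (auto simp: components_def)
      then have "a \<in> component G F v" using component_self[of a G F] by simp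
      then show False using v(2) component_eq_iff_mem[of G F v a] by simp
    qed
    moreover have "{?A, ?B} \<subseteq> components G F" using V by (simp add: components_def)
    then have "card (components G F - {?A, ?B}) + 2 = card (components G F)"
      using False finite_components[of F] card_mono[of "components G F" "{?A, ?B}"]
      by (simp add: card_Diff_subset)
    ultimately show ?thesis
      using False finite_components[of F] by (simp add: grank_def)
  qed
qed

lemma grank_insert_bounds:
  assumes "F \<subseteq> edges G" "x \<in> edges G"
  shows "grank G F \<le> grank G (insert x F)" "grank G (insert x F) \<le> grank G F + 1"
proof -
  obtain a b where ab: "ends G x = {a, b}" using ends_pair[of x] assms(2) by blast
  show "grank G F \<le> grank G (insert x F)" "grank G (insert x F) \<le> grank G F + 1"
    using grank_insert[OF _ ab, of F] assms by auto
qed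

text \<open>
  Adding an edge raises the rank iff its ends are not yet connected, which becomes harder to satisfy
  as the edge set grows. Submodularity follows by adding the edges of a set one at a time.
\<close>

lemma grank_diminishing:
  assumes "A \<subseteq> B" "insert x B \<subseteq> edges G"
  shows "grank G (insert x B) - grank G B \<le> grank G (insert x A) - grank G A"
proof -
  obtain a b where ab: "ends G x = {a, b}" using ends_pair[of x] assms(2) by blast
  have "component G B a = component G B b" if "component G A a = component G A b"
    using that component_mono[OF assms(1), of G a] by (simp add: component_eq_iff_mem subset_iff)
  moreover have "insert x A \<subseteq> edges G" using assms by blast
  ultimately show ?thesis
    using grank_insert[OF _ ab, of A] grank_insert[OF _ ab, of B] assms(2) by simp
qed

lemma grank_empty: "grank G {} = 0"
proof -
  have "component G {} v = {v}" for v by (simp add: component_def adj_def)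
  then have "components G {} = (\<lambda>v. {v}) ` verts G" by (simp add: components_def)
  then show ?thesis by (simp add: grank_def card_image)
qed

lemma grank_submodular:
  assumes "A \<subseteq> edges G" "B \<subseteq> edges G"
  shows "grank G (A \<union> B) + grank G (A \<inter> B) \<le> grank G A + grank G B"
proof -
  have *: "grank G (D \<union> Z) - grank G D \<le> grank G (C \<union> Z) - grank G C"
    if "C \<subseteq> D" "D \<union> Z \<subseteq> edges G" for C D Z
    using finite_subset[OF _ finite_edges, of Z] that
  proof (induction Z rule: infinite_finite_induct)
    case (insert x Z)
    have "grank G (insert x (D \<union> Z)) - grank G (D \<union> Z) \<le> grank G (insert x (C \<union> Z)) - grank G (C \<union> Z)"
      using insert.prems by (intro grank_diminishing) auto
    then show ?case using insert by auto
  qed auto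
  have "(A \<inter> B) \<union> B = B" "(A \<inter> B) \<union> A = A" by auto
  then show ?thesis using *[of "A \<inter> B" B A] assms by (simp add: Un_commute)
qed

sublocale gr: rank_function "edges G" "grank G"
  using finite_edges grank_empty grank_insert_bounds grank_submodular
  by unfold_locales auto

text \<open>
  Vertices outside \<open>X\<close> are isolated and contribute the same to \<open>|V|\<close> and to the number of components.
\<close>

lemma grank_within:
  assumes "F \<subseteq> edges G" "X \<subseteq> verts G" "\<And>x. x \<in> F \<Longrightarrow> ends G x \<subseteq> X"
  shows "grank G F = int (card X) - int (card (component G F ` X))"
proof -
  have out: "component G F v = {v}" if "v \<notin> X" for v
  proof -
    have "component G F v \<subseteq> {v}" using that assms(3) by (intro component_closed(1)) auto
    then show ?thesis using component_self by fast
  qed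
  have "component G F v \<subseteq> X" if "v \<in> X" for v
    using that assms(3) by (intro component_closed(1)) auto
  then have dis: "component G F ` X \<inter> (\<lambda>v. {v}) ` (verts G - X) = {}" by auto
  have "verts G = X \<union> (verts G - X)" using assms(2) by auto
  then have "components G F = component G F ` X \<union> component G F ` (verts G - X)"
    unfolding components_def by (metis image_Un)
  also have "component G F ` (verts G - X) = (\<lambda>v. {v}) ` (verts G - X)"
    using out by (intro image_cong) auto
  finally have "card (components G F) = card (component G F ` X) + card (verts G - X)"
    using dis finite_verts assms(2)
    by (simp add: card_Un_disjoint card_image finite_subset)
  moreover have "card (verts G) = card X + card (verts G - X)"
    using finite_verts assms(2) by (simp add: card_Diff_subset card_mono finite_subset)
  ultimately show ?thesis by (simp add: grank_def)
qed

lemma grank_le: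
  assumes "F \<subseteq> edges G" "X \<subseteq> verts G" "X \<noteq> {}" "\<And>x. x \<in> F \<Longrightarrow> ends G x \<subseteq> X"
  shows "grank G F \<le> int (card X) - 1"
proof -
  have "finite (component G F ` X)" using assms(2) finite_verts finite_subset by blast
  then have "card (component G F ` X) \<noteq> 0" using assms(3) by simp
  then show ?thesis using grank_within[OF assms(1,2,4)] by simp
qed

lemma grank_cut:
  assumes "F \<subseteq> edges G" "Y \<subseteq> verts G"
    and closed: "\<And>x. x \<in> F \<Longrightarrow> ends G x \<inter> Y \<noteq> {} \<Longrightarrow> ends G x \<subseteq> Y"
  shows "grank G F = grank G {x \<in> F. ends G x \<subseteq> Y} + grank G {x \<in> F. ends G x \<inter> Y = {}}"
proof -
  let ?Z = "verts G - Y"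
  have sub: "{x \<in> F. ends G x \<inter> Y = {}} = {x \<in> F. ends G x \<subseteq> ?Z}"
    using ends_subset assms(1) by auto
  have closed': "ends G x \<subseteq> ?Z" if "x \<in> F" "ends G x \<inter> ?Z \<noteq> {}" for x
    using that closed[OF that(1)] ends_subset[of x] assms(1) by auto
  have Y: "component G {x \<in> F. ends G x \<subseteq> Y} v = component G F v \<and> component G F v \<subseteq> Y"
    if "v \<in> Y" for v
    using component_closed[OF that closed] by simp
  have Z: "component G {x \<in> F. ends G x \<subseteq> ?Z} v = component G F v \<and> component G F v \<subseteq> ?Z"
    if "v \<in> ?Z" for v
    using component_closed[OF that closed'] by simp
  have "component G F u \<noteq> component G F v" if "u \<in> Y" "v \<in> ?Z" for u v
    using Y[OF that(1)] Z[OF that(2)] component_self[of u G F] by auto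
  then have "component G F ` Y \<inter> component G F ` ?Z = {}" by blast
  moreover have "verts G = Y \<union> ?Z" using assms(2) by auto
  then have "components G F = component G F ` Y \<union> component G F ` ?Z"
    unfolding components_def by (metis image_Un)
  ultimately have "card (components G F) = card (component G F ` Y) + card (component G F ` ?Z)"
    using finite_verts assms(2) by (simp add: card_Un_disjoint finite_subset)
  moreover have "card (verts G) = card Y + card ?Z"
    using finite_verts assms(2) by (simp add: card_Diff_subset card_mono finite_subset)
  moreover have "component G {x \<in> F. ends G x \<subseteq> Y} ` Y = component G F ` Y"
    "component G {x \<in> F. ends G x \<subseteq> ?Z} ` ?Z = component G F ` ?Z"
    using Y Z by (auto intro!: image_cong)
  moreover have "grank G {x \<in> F. ends G x \<subseteq> Y}
      = int (card Y) - int (card (component G {x \<in> F. ends G x \<subseteq> Y} ` Y))"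
    using assms by (intro grank_within) auto
  moreover have "grank G {x \<in> F. ends G x \<subseteq> ?Z}
      = int (card ?Z) - int (card (component G {x \<in> F. ends G x \<subseteq> ?Z} ` ?Z))"
    using assms by (intro grank_within) auto
  ultimately show ?thesis unfolding sub by (simp add: grank_def)
qed

text \<open>
  The rank falls short of \<open>|X| - 1\<close> only if the edges do not connect \<open>X\<close>; the component of any vertex
  of \<open>X\<close> is then the set \<open>Y\<close>.
\<close>

lemma grank_deficient:
  assumes "F \<subseteq> edges G" "X \<subseteq> verts G" "X \<noteq> {}" "\<And>x. x \<in> F \<Longrightarrow> ends G x \<subseteq> X"
    and "grank G F \<noteq> int (card X) - 1"
  obtains Y where "Y \<noteq> {}" "Y \<subset> X" "\<And>x. x \<in> F \<Longrightarrow> ends G x \<inter> Y \<noteq> {} \<Longrightarrow> ends G x \<subseteq> Y"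
proof -
  obtain v where v: "v \<in> X" using assms(3) by blast
  let ?Y = "component G F v"
  have sub: "?Y \<subseteq> X" using v assms(4) by (intro component_closed(1)) auto
  have "?Y \<noteq> X"
  proof
    assume *: "?Y = X"
    have "component G F ` X = {X}"
    proof (intro equalityI subsetI)
      fix C assume "C \<in> component G F ` X"
      then obtain u where "u \<in> X" "C = component G F u" by auto
      then show "C \<in> {X}" using * component_eq_iff_mem[of G F v u] by simp
    qed (use v * in auto)
    then show False using grank_within[OF assms(1,2,4)] assms(5) by simp
  qed
  moreover have "?Y \<noteq> {}" using component_self[of v G F] by blast
  ultimately show ?thesis using that[of ?Y] sub component_absorbs[OF assms(1)] by blast
qed

end

text \<open>
  In terms of numbers of components \<open>k\<close>, this is the number of loops plus
  \<open>k(A) + (\<Sum>v\<in>V. k(A - v) - k(A))\<close>, which counts blocks through the block-cut forest. The form with ranks is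
  additive over separators at sight.
\<close>

definition block_count :: "('v, 'e) pre_multigraph \<Rightarrow> 'e set \<Rightarrow> int" where
  "block_count G A = (\<Sum>x\<in>A. 1 - grank G {x}) - grank G A
    + (\<Sum>v\<in>verts G. grank G A - grank G {x \<in> A. v \<notin> ends G x})"

context multigraph
begin

lemma block_count_add:
  assumes "A \<subseteq> edges G" "separator (grank G) A S"
  shows "block_count G A = block_count G S + block_count G (A - S)"
proof -
  have S: "S \<subseteq> A" "grank G S + grank G (A - S) = grank G A"
    using assms(2) by (auto simp: separator_def)
  have "(\<Sum>x\<in>A. 1 - grank G {x}) = (\<Sum>x\<in>A - S. 1 - grank G {x}) + (\<Sum>x\<in>S. 1 - grank G {x})"
    using S(1) gr.finite_sub[OF assms(1)] by (rule sum.subset_diff)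
  moreover have "grank G A - grank G {x \<in> A. v \<notin> ends G x}
      = (grank G S - grank G {x \<in> S. v \<notin> ends G x})
        + (grank G (A - S) - grank G {x \<in> A - S. v \<notin> ends G x})" for v
  proof -
    have "{x \<in> A. v \<notin> ends G x} \<inter> S = {x \<in> S. v \<notin> ends G x}"
      "{x \<in> A. v \<notin> ends G x} - S = {x \<in> A - S. v \<notin> ends G x}" using S(1) by auto
    then show ?thesis
      using gr.separator_split[OF assms(2,1), of "{x \<in> A. v \<notin> ends G x}"] S(2) by simp
  qed
  ultimately show ?thesis
    using S(2) by (simp only: block_count_def sum.distrib)
qed

lemma grank_loop:
  assumes "x \<in> edges G" "ends G x = {v}"
  shows "grank G {x} = 0"
  using grank_insert[of x "{}" v v] assms by (simp add: grank_empty)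

lemma grank_nonloop:
  assumes "x \<in> edges G" "ends G x = {a, b}" "a \<noteq> b"
  shows "grank G {x} = 1"
proof -
  have "component G {} v = {v}" for v by (simp add: component_def adj_def)
  then show ?thesis using grank_insert[of x "{}" a b] assms by (simp add: grank_empty)
qed

lemma block_count_loop:
  assumes "x \<in> edges G" "grank G {x} = 0"
  shows "block_count G {x} = 1"
proof -
  have "grank G {y \<in> {x}. v \<notin> ends G y} = 0" for v
  proof (cases "v \<in> ends G x")
    case True
    then have "{y \<in> {x}. v \<notin> ends G y} = {}" by auto
    then show ?thesis by (simp only: grank_empty)
  next
    case False
    then have "{y \<in> {x}. v \<notin> ends G y} = {x}" by auto
    then show ?thesis by (simp only: assms(2))
  qed
  then show ?thesis using assms by (simp add: block_count_def)
qed

text \<open>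
  An indecomposable set with a loop is that loop. Otherwise, let \<open>X\<close> be the set of vertices met by \<open>A\<close>. A
  partition of \<open>X\<close>, or of \<open>X\<close> without one vertex \<open>v\<close>, into two sides with no edge between them splits \<open>A\<close>
  into two sets whose ranks add up to at most \<open>r A\<close>, contradicting indecomposability. So \<open>A\<close> has
  rank \<open>|X| - 1\<close> and \<open>A - \<delta>(v)\<close> has rank \<open>|X| - 2\<close>.
\<close>

lemma block_count_indecomposable:
  assumes "A \<subseteq> edges G" "indecomposable (grank G) A"
  shows "block_count G A = 1"
proof (cases "\<exists>x\<in>A. grank G {x} = 0")
  case True
  then obtain x where x: "x \<in> A" "grank G {x} = 0" by blast
  have "separator (grank G) A {x}"
    using x gr.r_mono[of "A - {x}" A] assms(1) by (intro gr.separatorI) auto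
  then have "A = {x}" using assms(2) by (auto simp: indecomposable_def)
  then show ?thesis using block_count_loop x assms(1) by simp
next
  case False
  have fin: "finite A" using gr.finite_sub[OF assms(1)] .
  have conn: "S = {} \<or> S = A" if "S \<subseteq> A" "grank G S + grank G (A - S) \<le> grank G A" for S
    using assms gr.separatorI[OF that(1) assms(1) that(2)] by (auto simp: indecomposable_def)
  have pair: "\<exists>a b. a \<noteq> b \<and> ends G x = {a, b}" if "x \<in> A" for x
  proof -
    obtain a b where "ends G x = {a, b}" using ends_pair[of x] \<open>x \<in> A\<close> assms(1) by blast
    moreover have "a \<noteq> b" using False \<open>x \<in> A\<close> assms(1) calculation grank_loop[of x a] by auto
    ultimately show ?thesis by blast
  qed
  have rank1: "grank G {x} = 1" if "x \<in> A" for x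
    using pair[OF that] grank_nonloop that assms(1) by blast
  define X where "X = \<Union>(ends G ` A)"
  have X: "X \<subseteq> verts G" "\<And>x. x \<in> A \<Longrightarrow> ends G x \<subseteq> X"
    using assms(1) ends_subset by (auto simp: X_def)
  have finX: "finite X" using X(1) finite_verts finite_subset by blast
  obtain x0 a0 b0 where x0: "x0 \<in> A" "a0 \<noteq> b0" "ends G x0 = {a0, b0}"
    using assms(2) pair by (fastforce simp: indecomposable_def)
  then have "{a0, b0} \<subseteq> X" using X(2) by blast
  then have X_ne: "X - {v} \<noteq> {}" for v using x0(2) by auto
  have rA: "grank G A = int (card X) - 1"
  proof (rule ccontr)
    assume *: "grank G A \<noteq> int (card X) - 1"
    obtain Y where Y: "Y \<noteq> {}" "Y \<subset> X" "\<And>x. x \<in> A \<Longrightarrow> ends G x \<inter> Y \<noteq> {} \<Longrightarrow> ends G x \<subseteq> Y"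
      using grank_deficient[OF assms(1) X(1) _ X(2) *] X_ne by blast
    let ?S = "{x \<in> A. ends G x \<subseteq> Y}"
    have T: "{x \<in> A. ends G x \<inter> Y = {}} = A - ?S"
    proof (intro equalityI subsetI)
      fix x assume "x \<in> {x \<in> A. ends G x \<inter> Y = {}}"
      moreover from this have "ends G x \<noteq> {}" using pair by blast
      ultimately show "x \<in> A - ?S" by auto
    qed (use Y(3) in auto)
    have "grank G ?S + grank G (A - ?S) \<le> grank G A"
      using grank_cut[OF assms(1) _ Y(3)] Y(2) X(1) T by auto
    then have "?S = {} \<or> ?S = A" by (intro conn) auto
    moreover obtain y where "y \<in> Y" "y \<in> X" using Y(1,2) by blast
    then obtain x where "x \<in> A" "y \<in> ends G x" "y \<in> Y" by (auto simp: X_def)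
    then have "x \<in> ?S" using Y(3) by auto
    moreover obtain z where "z \<in> X" "z \<notin> Y" using Y(2) by blast
    then obtain w where "w \<in> A" "z \<in> ends G w" "z \<notin> Y" by (auto simp: X_def)
    then have "w \<in> A - ?S" by auto
    ultimately show False by blast
  qed
  have star: "grank G {x \<in> A. v \<notin> ends G x} = int (card X) - 2" if v: "v \<in> X" for v
  proof (rule ccontr)
    let ?F = "{x \<in> A. v \<notin> ends G x}"
    assume "grank G ?F \<noteq> int (card X) - 2"
    then have *: "grank G ?F \<noteq> int (card (X - {v})) - 1"
      using v finX card_gt_0_iff[of X] by (auto simp: of_nat_diff)
    have F: "?F \<subseteq> edges G" "X - {v} \<subseteq> verts G" "\<And>x. x \<in> ?F \<Longrightarrow> ends G x \<subseteq> X - {v}"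
      using assms(1) X by auto
    obtain Y where Y: "Y \<noteq> {}" "Y \<subset> X - {v}"
      "\<And>x. x \<in> ?F \<Longrightarrow> ends G x \<inter> Y \<noteq> {} \<Longrightarrow> ends G x \<subseteq> Y"
      using grank_deficient[OF F(1,2) X_ne F(3) *] by blast
    \<comment> \<open>The edges from \<open>v\<close> to \<open>Y\<close> go with \<open>Y\<close>; the two parts share only the vertex \<open>v\<close>,
      which is why their ranks are bounded by \<open>|Y|\<close> and \<open>|X - Y| - 1\<close>.\<close>
    let ?S = "{x \<in> A. ends G x \<inter> Y \<noteq> {}}"
    have in_Yv: "ends G x \<subseteq> insert v Y" if "x \<in> ?S" for x
    proof (cases "v \<in> ends G x")
      case True
      then show ?thesis using pair[of x] that Y(2) by auto
    next
      case False
      then show ?thesis using Y(3)[of x] that by auto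
    qed
    have finY: "finite Y" using Y(2) finX by (metis finite_Diff finite_subset psubset_imp_subset)
    have "grank G ?S \<le> int (card (insert v Y)) - 1"
      using in_Yv assms(1) Y(2) X(1) v by (intro grank_le) auto
    also have "card (insert v Y) = card Y + 1" using Y(2) finY by (subst card_insert_disjoint) auto
    finally have S: "grank G ?S \<le> int (card Y)" by simp
    have "grank G (A - ?S) \<le> int (card (X - Y)) - 1"
      using assms(1) X v Y(2) by (intro grank_le) auto
    also have "card (X - Y) = card X - card Y" using Y(2) finY by (intro card_Diff_subset) auto
    also have "int (card X - card Y) = int (card X) - int (card Y)"
      using Y(2) finX by (intro of_nat_diff card_mono) auto
    finally have "grank G (A - ?S) \<le> int (card X) - int (card Y) - 1" .
    then have "grank G ?S + grank G (A - ?S) \<le> grank G A" using S rA by simp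
    then have "?S = {} \<or> ?S = A" by (intro conn) auto
    moreover obtain y where "y \<in> Y" "y \<in> X" using Y(1,2) by blast
    then have "?S \<noteq> {}" by (auto simp: X_def)
    moreover obtain z where "z \<in> X" "z \<notin> insert v Y" using Y(2) by blast
    then obtain w where "w \<in> A" "\<not> ends G w \<subseteq> insert v Y" by (auto simp: X_def)
    then have "w \<in> A - ?S" using in_Yv by blast
    ultimately show False by blast
  qed
  have "grank G A - grank G {x \<in> A. v \<notin> ends G x} = (if v \<in> X then 1 else 0)" for v
  proof (cases "v \<in> X")
    case False
    then have "{x \<in> A. v \<notin> ends G x} = A" by (auto simp: X_def)
    then show ?thesis using False by simp
  qed (use star rA in auto)
  then have "(\<Sum>v\<in>verts G. grank G A - grank G {x \<in> A. v \<notin> ends G x}) = int (card X)"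
    using X(1) finite_verts by (simp add: sum.If_cases Int_absorb1)
  then show ?thesis using rank1 rA by (simp add: block_count_def)
qed

theorem ncomp_grank:
  assumes "A \<subseteq> edges G"
  shows "int (ncomp (grank G) A) = block_count G A"
  using block_count_add block_count_indecomposable assms by (rule gr.ncomp_eqI)

end


section \<open>The alternating sum over edge sets of a graph\<close>

lemma alternating_sum_additive:
  fixes g :: "'a \<Rightarrow> int"
  assumes "finite E" "card E \<ge> 2"
  shows "(\<Sum>A\<in>Pow E. (-1) ^ card A * (\<Sum>x\<in>A. g x)) = 0"
proof -
  have "(\<Sum>A\<in>Pow E. (-1) ^ card A * (\<Sum>x\<in>A. g x))
      = (\<Sum>A\<in>Pow E. \<Sum>x\<in>E. (-1) ^ card A * (if x \<in> A then g x else 0))"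
  proof (rule sum.cong[OF refl])
    fix A assume "A \<in> Pow E"
    then have "(\<Sum>x\<in>A. g x) = (\<Sum>x\<in>E. if x \<in> A then g x else 0)"
      using assms(1) by (simp add: sum.If_cases Int_absorb1)
    then show "(-1) ^ card A * (\<Sum>x\<in>A. g x) = (\<Sum>x\<in>E. (-1) ^ card A * (if x \<in> A then g x else 0))"
      by (simp only: sum_distrib_left)
  qed
  also have "\<dots> = (\<Sum>x\<in>E. \<Sum>A\<in>Pow E. (-1) ^ card A * (if x \<in> A then g x else 0))"
    by (rule sum.swap)
  also have "\<dots> = 0"
  proof (rule sum.neutral, rule ballI)
    fix x assume "x \<in> E"
    then have "card (E - {x}) \<noteq> 0" using assms by simp
    then have "E - {x} \<noteq> {}" by (metis card.empty)
    then obtain y where "y \<in> E" "y \<noteq> x" by blast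
    then show "(\<Sum>A\<in>Pow E. (-1) ^ card A * (if x \<in> A then g x else 0)) = 0"
      using assms(1) by (intro alternating_sum_eq_0) auto
  qed
  finally show ?thesis .
qed

context multigraph
begin

abbreviation rank_sum :: int where
  "rank_sum \<equiv> (\<Sum>A\<in>Pow (edges G). (-1) ^ card A * grank G A)"

theorem alternating_sum_ncomp:
  assumes "card (edges G) \<ge> 2" and verts: "verts G = \<Union>(ends G ` edges G)"
  shows "(\<Sum>A\<in>Pow (edges G). (-1) ^ card A * int (ncomp (grank G) A))
    = grank G (edges G) * rank_sum"
proof -
  let ?E = "edges G" and ?V = "verts G" and ?r = "grank G"
  let ?st = "\<lambda>A v. {x \<in> A. v \<notin> ends G x}"
  have "(\<Sum>A\<in>Pow ?E. (-1) ^ card A * int (ncomp ?r A))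
      = (\<Sum>A\<in>Pow ?E. (-1) ^ card A * (\<Sum>x\<in>A. 1 - ?r {x})
          + (int (card ?V) - 1) * ((-1) ^ card A * ?r A)
          - (\<Sum>v\<in>?V. (-1) ^ card A * ?r (?st A v)))"
    by (rule sum.cong[OF refl])
      (simp add: ncomp_grank block_count_def sum_subtractf algebra_simps flip: sum_distrib_left)
  also have "\<dots> = (\<Sum>A\<in>Pow ?E. (-1) ^ card A * (\<Sum>x\<in>A. 1 - ?r {x}))
      + (int (card ?V) - 1) * rank_sum
      - (\<Sum>v\<in>?V. \<Sum>A\<in>Pow ?E. (-1) ^ card A * ?r (?st A v))"
    unfolding sum.distrib sum_subtractf sum_distrib_left sum.swap[of _ ?V] by (rule refl)
  also have "(\<Sum>A\<in>Pow ?E. (-1) ^ card A * (\<Sum>x\<in>A. 1 - ?r {x})) = 0"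
    by (rule alternating_sum_additive[OF finite_edges assms(1)])
  also have "(\<Sum>v\<in>?V. \<Sum>A\<in>Pow ?E. (-1) ^ card A * ?r (?st A v)) = 0"
  proof (rule sum.neutral, rule ballI)
    fix v assume "v \<in> ?V"
    then obtain x where x: "x \<in> ?E" "v \<in> ends G x" using verts by auto
    have "?st (insert x A) v = ?st A v" for A using x(2) by auto
    then show "(\<Sum>A\<in>Pow ?E. (-1) ^ card A * ?r (?st A v)) = 0"
      using x(1) by (intro alternating_sum_eq_0[OF finite_edges]) auto
  qed
  \<comment> \<open>Either the graph is connected, or both sides vanish. In the latter case an edge on one side of the
    cut is invisible to the summand of the rank that lives on the other side.\<close>
  also have "0 + (int (card ?V) - 1) * rank_sum - 0 = ?r ?E * rank_sum"
  proof (cases "?r ?E = int (card ?V) - 1")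
    case False
    have ne: "?V \<noteq> {}"
    proof -
      have "?E \<noteq> {}" using assms(1) by auto
      then obtain x where x: "x \<in> ?E" by blast
      then have "ends G x \<noteq> {}" using ends_pair by blast
      then show ?thesis using ends_subset[OF x] by blast
    qed
    obtain Y where Y: "Y \<noteq> {}" "Y \<subset> ?V" "\<And>x. x \<in> ?E \<Longrightarrow> ends G x \<inter> Y \<noteq> {} \<Longrightarrow> ends G x \<subseteq> Y"
      using grank_deficient[OF _ _ ne ends_subset False] by blast
    obtain y where "y \<in> Y" "y \<in> ?V" using Y by blast
    then obtain p where p: "p \<in> ?E" "ends G p \<inter> Y \<noteq> {}" using verts by auto
    obtain z where "z \<notin> Y" "z \<in> ?V" using Y by blast
    then obtain q where q: "q \<in> ?E" "\<not> ends G q \<subseteq> Y" using verts by auto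
    have "rank_sum = (\<Sum>A\<in>Pow ?E. (-1) ^ card A * ?r {x \<in> A. ends G x \<subseteq> Y}
        + (-1) ^ card A * ?r {x \<in> A. ends G x \<inter> Y = {}})"
    proof (rule sum.cong[OF refl])
      fix A assume "A \<in> Pow ?E"
      then have "?r A = ?r {x \<in> A. ends G x \<subseteq> Y} + ?r {x \<in> A. ends G x \<inter> Y = {}}"
        using Y by (intro grank_cut) auto
      then show "(-1) ^ card A * ?r A = (-1) ^ card A * ?r {x \<in> A. ends G x \<subseteq> Y}
          + (-1) ^ card A * ?r {x \<in> A. ends G x \<inter> Y = {}}"
        by (simp add: distrib_left)
    qed
    also have "\<dots> = (\<Sum>A\<in>Pow ?E. (-1) ^ card A * ?r {x \<in> A. ends G x \<subseteq> Y})
        + (\<Sum>A\<in>Pow ?E. (-1) ^ card A * ?r {x \<in> A. ends G x \<inter> Y = {}})"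
      by (rule sum.distrib)
    also have "(\<Sum>A\<in>Pow ?E. (-1) ^ card A * ?r {x \<in> A. ends G x \<subseteq> Y}) = 0"
    proof (rule alternating_sum_eq_0[OF finite_edges q(1)])
      have "{x \<in> insert q A. ends G x \<subseteq> Y} = {x \<in> A. ends G x \<subseteq> Y}" for A using q(2) by auto
      then show "?r {x \<in> insert q A. ends G x \<subseteq> Y} = ?r {x \<in> A. ends G x \<subseteq> Y}" for A by simp
    qed
    also have "(\<Sum>A\<in>Pow ?E. (-1) ^ card A * ?r {x \<in> A. ends G x \<inter> Y = {}}) = 0"
    proof (rule alternating_sum_eq_0[OF finite_edges p(1)])
      have "{x \<in> insert p A. ends G x \<inter> Y = {}} = {x \<in> A. ends G x \<inter> Y = {}}" for A using p(2) by auto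
      then show "?r {x \<in> insert p A. ends G x \<inter> Y = {}} = ?r {x \<in> A. ends G x \<inter> Y = {}}" for A by simp
    qed
    finally have "rank_sum = 0" by simp
    then show ?thesis by (simp only: mult_zero_right add_0 diff_0_right)
  qed simp
  finally show ?thesis .
qed

end


section \<open>Contraction\<close>

text \<open>
  A vertex of the contraction is the set of original vertices identified to it. The edges in \<open>B\<close> are
  removed, so that exactly the remaining edges with both ends in one such set are loops.
\<close>

definition contract :: "('v, 'e) pre_multigraph \<Rightarrow> 'e set \<Rightarrow> ('v set, 'e) pre_multigraph" where
  "contract G B = \<lparr>verts = components G B, edges = edges G - B,
    ends = (\<lambda>x. component G B ` ends G x)\<rparr>"

text \<open>
  Used to compare the components of a contraction, which are sets of sets of vertices, with those of the
  original graph.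
\<close>

lemma card_image_cong_kernel:
  assumes "\<And>v w. v \<in> V \<Longrightarrow> w \<in> V \<Longrightarrow> f v = f w \<longleftrightarrow> g v = g w"
  shows "card (f ` V) = card (g ` V)"
proof -
  let ?h = "\<lambda>c. g (inv_into V f c)"
  have h: "?h (f v) = g v" if "v \<in> V" for v
    using assms[of "inv_into V f (f v)" v] that by (simp add: inv_into_into f_inv_into_f)
  have "?h ` (f ` V) = g ` V" using h by (auto simp: image_image)
  moreover have "inj_on ?h (f ` V)" using h assms by (auto simp: inj_on_def)
  ultimately show ?thesis by (metis card_image)
qed

context multigraph
begin

lemma multigraph_contract:
  assumes "B \<subseteq> edges G"
  shows "multigraph (contract G B)"
proof
  show "finite (verts (contract G B))" "finite (edges (contract G B))"
    using finite_components finite_edges by (auto simp: contract_def)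
next
  fix x assume "x \<in> edges (contract G B)"
  then have x: "x \<in> edges G" by (simp add: contract_def)
  show "ends (contract G B) x \<subseteq> verts (contract G B)"
    using ends_subset[OF x] by (auto simp: contract_def components_def)
  obtain a b where "ends G x = {a, b}" using ends_pair[OF x] by blast
  then show "card (ends (contract G B) x) \<in> {1, 2}"
    by (cases "component G B a = component G B b") (simp_all add: contract_def)
qed

lemma component_contract:
  assumes "B \<subseteq> edges G" "A \<subseteq> edges G - B"
  shows "component (contract G B) A (component G B v) = component (contract G B) A (component G B w)
    \<longleftrightarrow> component G (A \<union> B) v = component G (A \<union> B) w"
proof
  have B: "component G (A \<union> B) u = component G (A \<union> B) w"
    if "component G B u = component G B w" for u w
    using that component_mono[of B "A \<union> B" G u] unfolding component_eq_iff_mem by auto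
  have *: "\<forall>w. D = component G B w \<longrightarrow> component G (A \<union> B) v = component G (A \<union> B) w"
    if "(component G B v, D) \<in> (adj (contract G B) A)\<^sup>*" for D
    using that
  proof (induction rule: rtrancl_induct)
    case base
    then show ?case using B by blast
  next
    case (step D D')
    then obtain x where x: "x \<in> A" "component G B ` ends G x = {D, D'}"
      by (auto simp: adj_def contract_def)
    then obtain a b where ab: "ends G x = {a, b}" using ends_pair[of x] assms(2) by blast
    have eq: "component G (A \<union> B) a = component G (A \<union> B) b"
      using component_edge[OF _ ab] x(1) by blast
    show ?case
    proof (intro allI impI)
      fix w assume w: "D' = component G B w"
      consider "D = component G B a" "D' = component G B b"
        | "D = component G B b" "D' = component G B a"
        using x(2) unfolding ab by (auto simp: doubleton_eq_iff)
      then show "component G (A \<union> B) v = component G (A \<union> B) w"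
        using step.IH B w eq by cases metis+
    qed
  qed
  show "component G (A \<union> B) v = component G (A \<union> B) w"
    if "component (contract G B) A (component G B v) = component (contract G B) A (component G B w)"
    using that * by (simp add: component_eq_iff)
  show "component (contract G B) A (component G B v) = component (contract G B) A (component G B w)"
    if "component G (A \<union> B) v = component G (A \<union> B) w"
    using that[unfolded component_eq_iff]
  proof (induction rule: rtrancl_induct)
    case (step u w)
    then obtain x where x: "x \<in> A \<union> B" "ends G x = {u, w}" by (auto simp: adj_def)
    have "component (contract G B) A (component G B u) = component (contract G B) A (component G B w)"
    proof (cases "x \<in> B")
      case True
      then show ?thesis using x component_edge by metis
    next
      case False
      then show ?thesis using x by (intro component_edge[of x]) (auto simp: contract_def)
    qed
    then show ?case using step.IH by simp
  qed simp
qed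

lemma grank_contract:
  assumes "B \<subseteq> edges G" "A \<subseteq> edges G - B"
  shows "grank (contract G B) A = grank G (A \<union> B) - grank G B"
proof -
  have "components (contract G B) A = (\<lambda>v. component (contract G B) A (component G B v)) ` verts G"
    by (auto simp: components_def contract_def)
  also have "card \<dots> = card (component G (A \<union> B) ` verts G)"
    by (rule card_image_cong_kernel) (rule component_contract[OF assms])
  finally show ?thesis by (simp add: grank_def components_def contract_def)
qed

lemma grank_component:
  assumes "B \<subseteq> edges G" "C \<in> components G B"
  shows "grank G {x \<in> B. ends G x \<subseteq> C} = int (card C) - 1"
proof (rule ccontr)
  assume *: "grank G {x \<in> B. ends G x \<subseteq> C} \<noteq> int (card C) - 1"
  obtain v where v: "v \<in> verts G" "C = component G B v" using assms(2) by (auto simp: components_def)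
  have C: "{x \<in> B. ends G x \<subseteq> C} \<subseteq> edges G" "C \<subseteq> verts G" "C \<noteq> {}"
    using assms(1) v component_subset_verts[OF assms(1) v(1)] component_self[of v G B] by auto
  obtain Y where Y: "Y \<noteq> {}" "Y \<subset> C"
    "\<And>x. x \<in> {x \<in> B. ends G x \<subseteq> C} \<Longrightarrow> ends G x \<inter> Y \<noteq> {} \<Longrightarrow> ends G x \<subseteq> Y"
    using grank_deficient[OF C _ *] by blast
  obtain y where y: "y \<in> Y" "y \<in> C" using Y by blast
  have "component G B y \<subseteq> Y"
  proof (rule component_closed(1)[OF y(1)])
    fix x assume x: "x \<in> B" "ends G x \<inter> Y \<noteq> {}"
    then have "ends G x \<subseteq> C" using component_absorbs[OF assms(1)] Y(2) v(2) by blast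
    then show "ends G x \<subseteq> Y" using x Y(3) by blast
  qed
  moreover have "component G B y = C" using y(2) v(2) component_eq_iff_mem by metis
  ultimately show False using Y(2) by blast
qed

text \<open>
  Undoing the contraction, the edges not at the vertex \<open>C\<close> together with \<open>B\<close> fall into those of \<open>B\<close> inside
  \<open>C\<close>, which connect \<open>C\<close>, and all the edges of the graph that avoid \<open>C\<close>.
\<close>

lemma grank_contract_star:
  assumes "B \<subseteq> edges G" "C \<in> components G B"
  shows "grank (contract G B) {x \<in> edges G - B. C \<notin> ends (contract G B) x}
    = int (card C) - 1 + grank G {x \<in> edges G. ends G x \<inter> C = {}} - grank G B"
proof -
  let ?A = "{x \<in> edges G - B. C \<notin> ends (contract G B) x}"
  obtain v where v: "v \<in> verts G" "C = component G B v" using assms(2) by (auto simp: components_def)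
  have "C = component G B u \<longleftrightarrow> u \<in> C" for u using v(2) component_eq_iff_mem by metis
  then have A: "?A = {x \<in> edges G - B. ends G x \<inter> C = {}}"
    by (auto simp: contract_def)
  have "grank G (?A \<union> B) = grank G {x \<in> ?A \<union> B. ends G x \<subseteq> C} + grank G {x \<in> ?A \<union> B. ends G x \<inter> C = {}}"
  proof (rule grank_cut)
    show "?A \<union> B \<subseteq> edges G" using assms(1) by auto
    show "C \<subseteq> verts G" using v component_subset_verts[OF assms(1)] by simp
    fix x assume "x \<in> ?A \<union> B" "ends G x \<inter> C \<noteq> {}"
    then show "ends G x \<subseteq> C" using A component_absorbs[OF assms(1)] v(2) by blast
  qed
  also have "{x \<in> ?A \<union> B. ends G x \<inter> C = {}} = {x \<in> edges G. ends G x \<inter> C = {}}"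
    using assms(1) unfolding A by auto
  also have "ends G x \<noteq> {}" if "x \<in> edges G" for x using ends_pair[OF that] by auto
  then have "{x \<in> ?A \<union> B. ends G x \<subseteq> C} = {x \<in> B. ends G x \<subseteq> C}" unfolding A by auto
  finally show ?thesis
    using grank_component[OF assms] grank_contract[OF assms(1), of ?A] by auto
qed

lemma sum_card_components:
  assumes "B \<subseteq> edges G"
  shows "(\<Sum>C\<in>components G B. int (card C)) = int (card (verts G))"
proof -
  have "component G B u = component G B v" if "w \<in> component G B u" "w \<in> component G B v" for u v w
    using that by (simp flip: component_eq_iff_mem)
  then have "disjoint (components G B)"
    unfolding disjoint_def components_def by blast
  moreover have "\<Union>(components G B) = verts G"
    unfolding components_def using component_subset_verts[OF assms] component_self[of _ G B] by blast
  moreover from this have "finite C" if "C \<in> components G B" for C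
    using that finite_verts by (metis Sup_upper finite_subset)
  ultimately have "card (verts G) = sum card (components G B)"
    using card_Union_disjoint[of "components G B"] by (auto simp: disjoint_def pairwise_def disjnt_def)
  then show ?thesis by simp
qed

lemma components_insert_outside:
  assumes "insert x B \<subseteq> edges G" "ends G x \<inter> C = {}"
  shows "C \<in> components G (insert x B) \<longleftrightarrow> C \<in> components G B"
proof -
  obtain a b where ab: "ends G x = {a, b}" using ends_pair[of x] assms(1) by blast
  have a: "a \<in> component G F a" "b \<in> component G F b" for F
    by (simp_all add: component_self)
  have "C = component G (insert x B) v \<longleftrightarrow> C = component G B v" for v
  proof (cases "v \<in> component G B a \<union> component G B b")
    case True
    then have "component G B v = component G B a \<or> component G B v = component G B b"
      by (auto simp flip: component_eq_iff_mem)
    then show ?thesis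
      using True component_insert[OF assms(1) ab, of v] assms(2) a[of B] unfolding ab by auto
  next
    case False
    then show ?thesis using component_insert[OF assms(1) ab, of v] by simp
  qed
  then show ?thesis by (auto simp: components_def)
qed

text \<open>
  Exchange the sums: for a fixed vertex set \<open>C\<close> avoided by some edge \<open>x\<close>, being a component of \<open>B\<close> does not
  depend on whether \<open>x \<in> B\<close>, so \<open>C\<close> contributes 0. Hence only vertex covers \<open>C\<close> matter.
\<close>

lemma alternating_sum_components:
  fixes g :: "'v set \<Rightarrow> int"
  assumes "\<And>C. C \<subseteq> verts G \<Longrightarrow> (\<And>x. x \<in> edges G \<Longrightarrow> ends G x \<inter> C \<noteq> {}) \<Longrightarrow> g C = 0"
  shows "(\<Sum>B\<in>Pow (edges G). (-1) ^ card B * (\<Sum>C\<in>components G B. g C)) = 0"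
proof -
  let ?i = "\<lambda>B C. if C \<in> components G B then g C else 0"
  have "(\<Sum>B\<in>Pow (edges G). (-1) ^ card B * (\<Sum>C\<in>components G B. g C))
      = (\<Sum>B\<in>Pow (edges G). \<Sum>C\<in>Pow (verts G). (-1) ^ card B * ?i B C)"
  proof (rule sum.cong[OF refl])
    fix B assume "B \<in> Pow (edges G)"
    then have "components G B \<subseteq> Pow (verts G)"
      using component_subset_verts[of B] by (auto simp: components_def)
    then have "(\<Sum>C\<in>components G B. g C) = (\<Sum>C\<in>Pow (verts G). ?i B C)"
      using finite_verts by (simp add: sum.If_cases Int_absorb1)
    then show "(-1) ^ card B * (\<Sum>C\<in>components G B. g C)
        = (\<Sum>C\<in>Pow (verts G). (-1) ^ card B * ?i B C)"
      by (simp only: sum_distrib_left)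
  qed
  also have "\<dots> = (\<Sum>C\<in>Pow (verts G). \<Sum>B\<in>Pow (edges G). (-1) ^ card B * ?i B C)"
    by (rule sum.swap)
  also have "\<dots> = 0"
  proof (rule sum.neutral, rule ballI)
    fix C assume C: "C \<in> Pow (verts G)"
    show "(\<Sum>B\<in>Pow (edges G). (-1) ^ card B * ?i B C) = 0"
    proof (cases "\<exists>x\<in>edges G. ends G x \<inter> C = {}")
      case True
      then obtain x where x: "x \<in> edges G" "ends G x \<inter> C = {}" by blast
      have "C \<in> components G (insert x B) \<longleftrightarrow> C \<in> components G B" if "B \<subseteq> edges G - {x}" for B
        using x that by (intro components_insert_outside) auto
      then show ?thesis using alternating_sum_eq_0[OF finite_edges x(1)] by simp
    next
      case False
      then have "g C = 0" using C assms by blast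
      then show ?thesis by (intro sum.neutral) auto
    qed
  qed
  finally show ?thesis .
qed

text \<open>
  The summand is 1 iff \<open>x\<close> is a loop in the contraction of \<open>B\<close>. Each edge \<open>x\<close> contributes the full \<open>rank_sum\<close>,
  since \<open>rank_sum\<close> is itself the alternating sum of \<open>r B - r (B \<union> {x})\<close> over the sets \<open>B\<close> not containing \<open>x\<close>.
\<close>

lemma alternating_sum_loops:
  assumes "card (edges G) \<ge> 2"
  shows "(\<Sum>B\<in>Pow (edges G). (-1) ^ card B *
      (\<Sum>x\<in>edges G - B. 1 + grank G B - grank G (insert x B))) = int (card (edges G)) * rank_sum"
proof -
  let ?E = "edges G" and ?r = "grank G"
  let ?l = "\<lambda>B x. if x \<in> B then 0 else 1 + ?r B - ?r (insert x B)"
  have "(\<Sum>B\<in>Pow ?E. (-1) ^ card B * (\<Sum>x\<in>?E - B. 1 + ?r B - ?r (insert x B)))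
      = (\<Sum>B\<in>Pow ?E. \<Sum>x\<in>?E. (-1) ^ card B * ?l B x)"
  proof (rule sum.cong[OF refl])
    fix B assume "B \<in> Pow ?E"
    have "(\<Sum>x\<in>?E - B. 1 + ?r B - ?r (insert x B)) = (\<Sum>x\<in>?E. ?l B x)"
      using finite_edges by (intro sum.mono_neutral_cong_left) auto
    then show "(-1) ^ card B * (\<Sum>x\<in>?E - B. 1 + ?r B - ?r (insert x B))
        = (\<Sum>x\<in>?E. (-1) ^ card B * ?l B x)"
      by (simp only: sum_distrib_left)
  qed
  also have "\<dots> = (\<Sum>x\<in>?E. \<Sum>B\<in>Pow ?E. (-1) ^ card B * ?l B x)"
    by (rule sum.swap)
  also have "\<dots> = (\<Sum>x\<in>?E. rank_sum)"
  proof (rule sum.cong[OF refl])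
    fix x assume x: "x \<in> ?E"
    then have "card (?E - {x}) \<noteq> 0" using assms finite_edges by simp
    then have ne: "?E - {x} \<noteq> {}" by (metis card.empty)
    have "(\<Sum>B\<in>Pow ?E. (-1) ^ card B * ?l B x)
        = (\<Sum>B\<in>Pow (?E - {x}). (-1) ^ card B * (?l B x - ?l (insert x B) x))"
      by (rule alternating_sum_split[OF finite_edges x])
    also have "\<dots> = (\<Sum>B\<in>Pow (?E - {x}). (-1) ^ card B * 1 + (-1) ^ card B * (?r B - ?r (insert x B)))"
      by (rule sum.cong[OF refl]) (auto simp: algebra_simps)
    also have "\<dots> = (\<Sum>B\<in>Pow (?E - {x}). (-1) ^ card B * 1)
        + (\<Sum>B\<in>Pow (?E - {x}). (-1) ^ card B * (?r B - ?r (insert x B)))"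
      by (rule sum.distrib)
    also have "(\<Sum>B\<in>Pow (?E - {x}). (-1) ^ card B * (1::int)) = 0"
      using finite_edges ne by (intro alternating_sum_const) auto
    also have "(\<Sum>B\<in>Pow (?E - {x}). (-1) ^ card B * (?r B - ?r (insert x B))) = rank_sum"
      by (rule alternating_sum_split[OF finite_edges x, symmetric])
    finally show "(\<Sum>B\<in>Pow ?E. (-1) ^ card B * ?l B x) = rank_sum" by simp
  qed
  finally show ?thesis by simp
qed

text \<open>
  The block formula for the contraction of \<open>B\<close>, whose vertices \<open>C\<close> satisfy \<open>(\<Sum>C. |C|) = |V|\<close> and number
  \<open>|V| - r B\<close>. It is arranged by the dependence on \<open>B\<close>: loops, a multiple of \<open>r B\<close>, a constant, and a sum over components.
\<close>

lemma ncomp_contraction: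
  assumes "B \<subseteq> edges G"
  shows "int (ncomp (\<lambda>A. grank G (A \<union> B) - grank G B) (edges G - B))
    = (\<Sum>x\<in>edges G - B. 1 + grank G B - grank G (insert x B)) - grank G (edges G) * grank G B
      + grank G (edges G) * (int (card (verts G)) - 1)
      - (\<Sum>C\<in>components G B. grank G {x \<in> edges G. ends G x \<inter> C = {}})"
proof -
  let ?E = "edges G" and ?r = "grank G" and ?G = "contract G B"
  let ?\<rho> = "\<lambda>C. ?r {x \<in> ?E. ends G x \<inter> C = {}}"
  have rE: "grank ?G (?E - B) = ?r ?E - ?r B"
    using grank_contract[OF assms, of "?E - B"] assms by (simp add: Un_absorb2)
  have "ncomp (\<lambda>A. ?r (A \<union> B) - ?r B) (?E - B) = ncomp (grank ?G) (?E - B)"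
  proof (rule ncomp_cong)
    fix S assume S: "S \<subseteq> ?E - B"
    have "grank ?G S = ?r (S \<union> B) - ?r B" using S by (intro grank_contract[OF assms])
    moreover have "grank ?G (?E - B - S) = ?r ((?E - B - S) \<union> B) - ?r B"
      by (intro grank_contract[OF assms]) auto
    moreover have "(?E - B) \<union> B = ?E" using assms by auto
    ultimately show "separator (\<lambda>A. ?r (A \<union> B) - ?r B) (?E - B) S \<longleftrightarrow> separator (grank ?G) (?E - B) S"
      using rE by (simp add: separator_def)
  qed
  also have "int \<dots> = block_count ?G (?E - B)"
    by (rule multigraph.ncomp_grank[OF multigraph_contract[OF assms]]) (simp add: contract_def)
  also have "\<dots> = (\<Sum>x\<in>?E - B. 1 - grank ?G {x}) - (?r ?E - ?r B)
      + (\<Sum>C\<in>components G B. grank ?G (?E - B) - grank ?G {x \<in> ?E - B. C \<notin> ends ?G x})"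
    by (simp only: block_count_def rE) (simp add: contract_def)
  also have "(\<Sum>x\<in>?E - B. 1 - grank ?G {x}) = (\<Sum>x\<in>?E - B. 1 + ?r B - ?r (insert x B))"
    using grank_contract[OF assms] by (intro sum.cong[OF refl]) auto
  also have "(\<Sum>C\<in>components G B. grank ?G (?E - B) - grank ?G {x \<in> ?E - B. C \<notin> ends ?G x})
      = (\<Sum>C\<in>components G B. (?r ?E + 1) - int (card C) - ?\<rho> C)"
    using grank_contract_star[OF assms] rE by (intro sum.cong[OF refl]) auto
  also have "\<dots> = int (card (components G B)) * (?r ?E + 1) - int (card (verts G)) - (\<Sum>C\<in>components G B. ?\<rho> C)"
    by (simp add: sum_subtractf sum_card_components[OF assms])
  also have "int (card (components G B)) = int (card (verts G)) - ?r B"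
    by (simp add: grank_def)
  finally show ?thesis by (simp add: algebra_simps)
qed

theorem alternating_sum_ncomp_contract:
  assumes "card (edges G) \<ge> 2"
  shows "(\<Sum>B\<in>Pow (edges G). (-1) ^ card B *
      int (ncomp (\<lambda>A. grank G (A \<union> B) - grank G B) (edges G - B)))
    = (int (card (edges G)) - grank G (edges G)) * rank_sum"
proof -
  let ?E = "edges G" and ?r = "grank G"
  let ?\<rho> = "\<lambda>C. ?r {x \<in> ?E. ends G x \<inter> C = {}}"
  let ?l = "\<lambda>B. \<Sum>x\<in>?E - B. 1 + ?r B - ?r (insert x B)"
  let ?c = "?r ?E * (int (card (verts G)) - 1)"
  have "(\<Sum>B\<in>Pow ?E. (-1) ^ card B * int (ncomp (\<lambda>A. ?r (A \<union> B) - ?r B) (?E - B)))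
      = (\<Sum>B\<in>Pow ?E. (-1) ^ card B * ?l B - ?r ?E * ((-1) ^ card B * ?r B)
          + (-1) ^ card B * ?c - (-1) ^ card B * (\<Sum>C\<in>components G B. ?\<rho> C))"
    by (rule sum.cong[OF refl]) (simp only: Pow_iff ncomp_contraction ring_distribs mult.left_commute)
  also have "\<dots> = (\<Sum>B\<in>Pow ?E. (-1) ^ card B * ?l B) - ?r ?E * rank_sum
      + (\<Sum>B\<in>Pow ?E. (-1) ^ card B * ?c)
      - (\<Sum>B\<in>Pow ?E. (-1) ^ card B * (\<Sum>C\<in>components G B. ?\<rho> C))"
    by (simp only: sum.distrib sum_subtractf sum_distrib_left[of "?r ?E"])
  also have "(\<Sum>B\<in>Pow ?E. (-1) ^ card B * ?l B) = int (card ?E) * rank_sum"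
    by (rule alternating_sum_loops[OF assms])
  also have "(\<Sum>B\<in>Pow ?E. (-1) ^ card B * ?c) = 0"
    using assms finite_edges by (intro alternating_sum_const) auto
  also have "(\<Sum>B\<in>Pow ?E. (-1) ^ card B * (\<Sum>C\<in>components G B. ?\<rho> C)) = 0"
  proof (rule alternating_sum_components)
    fix C assume "\<And>x. x \<in> ?E \<Longrightarrow> ends G x \<inter> C \<noteq> {}"
    then have "{x \<in> ?E. ends G x \<inter> C = {}} = {}" by blast
    then show "?\<rho> C = 0" by (simp only: grank_empty)
  qed
  finally show ?thesis by (simp only: left_diff_distrib add_0_right diff_0_right)
qed

end


section \<open>Rank and components of matroids\<close>

context matroid
begin

lemma indep_finite: "I \<in> indep_sets M \<Longrightarrow> finite I"
  using indep_sets_subset finite_ground finite_subset by blast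

lemma finite_indep_sets: "finite (indep_sets M)"
  using indep_sets_subset finite_ground by (meson finite_Pow_iff finite_subset)

lemma card_le_rank_of: "I \<in> indep_sets M \<Longrightarrow> I \<subseteq> A \<Longrightarrow> card I \<le> rank_of M A"
  unfolding rank_of_def using finite_indep_sets by (intro Max_ge) auto

lemma rank_of_attained:
  obtains I where "I \<in> indep_sets M" "I \<subseteq> A" "card I = rank_of M A"
proof -
  have "rank_of M A \<in> card ` {I \<in> indep_sets M. I \<subseteq> A}"
    unfolding rank_of_def using finite_indep_sets empty_indep by (intro Max_in) auto
  then show ?thesis using that by auto
qed

lemma rank_of_le_card: "finite A \<Longrightarrow> rank_of M A \<le> card A"
  by (metis card_mono rank_of_attained)

lemma indep_extend:
  assumes "J \<in> indep_sets M" "J \<subseteq> A"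
  obtains I where "I \<in> indep_sets M" "J \<subseteq> I" "I \<subseteq> A" "card I = rank_of M A"
proof -
  have "\<exists>I\<in>indep_sets M. J \<subseteq> I \<and> I \<subseteq> A \<and> card I = rank_of M A"
    using assms
  proof (induction "rank_of M A - card J" arbitrary: J rule: less_induct)
    case less
    show ?case
    proof (cases "card J = rank_of M A")
      case False
      then have lt: "card J < rank_of M A" using card_le_rank_of[OF less.prems] False by simp
      obtain K where K: "K \<in> indep_sets M" "K \<subseteq> A" "card K = rank_of M A"
        by (rule rank_of_attained)
      obtain x where x: "x \<in> K - J" "insert x J \<in> indep_sets M"
        using augmentation[OF less.prems(1) K(1)] K(3) lt by auto
      have "rank_of M A - card (insert x J) < rank_of M A - card J"
        using x(1) lt indep_finite[OF less.prems(1)] by auto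
      then show ?thesis using less.hyps[of "insert x J"] x K(2) less.prems(2) by auto
    qed (use less.prems in auto)
  qed
  then show ?thesis using that by blast
qed

lemma indep_iff_rank_of:
  assumes "finite A"
  shows "A \<in> indep_sets M \<longleftrightarrow> rank_of M A = card A"
proof
  show "rank_of M A = card A" if "A \<in> indep_sets M"
    using card_le_rank_of[OF that order_refl] rank_of_le_card[OF assms] by simp
  show "A \<in> indep_sets M" if "rank_of M A = card A"
    using that assms by (metis card_subset_eq rank_of_attained)
qed

lemma rank_of_mono: "A \<subseteq> B \<Longrightarrow> rank_of M A \<le> rank_of M B"
  by (metis card_le_rank_of order_trans rank_of_attained)

lemma rank_function_rank_of: "rank_function (ground M) (\<lambda>A. int (rank_of M A))"
proof
  show "finite (ground M)" by (rule finite_ground)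
  show "int (rank_of M {}) = 0" using rank_of_le_card[of "{}"] by simp
  show "int (rank_of M A) \<le> int (rank_of M (insert x A))" for A x
    using rank_of_mono[of A "insert x A"] by auto
  show "int (rank_of M (insert x A)) \<le> int (rank_of M A) + 1" for A x
  proof -
    obtain I where I: "I \<in> indep_sets M" "I \<subseteq> insert x A" "card I = rank_of M (insert x A)"
      by (rule rank_of_attained)
    have "card (I - {x}) \<le> rank_of M A"
      using I indep_mono[OF I(1), of "I - {x}"] by (intro card_le_rank_of) auto
    then show ?thesis using I(3) card_Diff1_le[of I x] by (simp add: card_Diff_singleton_if split: if_splits)
  qed
  show "int (rank_of M (A \<union> B)) + int (rank_of M (A \<inter> B)) \<le> int (rank_of M A) + int (rank_of M B)" for A B
  proof -
    obtain J where J: "J \<in> indep_sets M" "J \<subseteq> A \<inter> B" "card J = rank_of M (A \<inter> B)"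
      by (rule rank_of_attained)
    obtain I where I: "I \<in> indep_sets M" "J \<subseteq> I" "I \<subseteq> A \<union> B" "card I = rank_of M (A \<union> B)"
      using indep_extend[OF J(1), of "A \<union> B"] J(2) by blast
    have "card (I \<inter> A) \<le> rank_of M A" "card (I \<inter> B) \<le> rank_of M B"
      using indep_mono[OF I(1)] by (auto intro!: card_le_rank_of)
    moreover have "card (I \<inter> A) + card (I \<inter> B) = card (I \<inter> A \<union> I \<inter> B) + card (I \<inter> A \<inter> (I \<inter> B))"
      using indep_finite[OF I(1)] by (intro card_Un_Int) auto
    moreover have "I \<inter> A \<union> I \<inter> B = I" using I(3) by auto
    moreover have "card J \<le> card (I \<inter> A \<inter> (I \<inter> B))"
      using I(2) J(2) indep_finite[OF I(1)] by (intro card_mono) auto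
    ultimately show ?thesis using I(4) J(3) by simp
  qed
qed

lemma matroid_restriction:
  assumes "A \<subseteq> ground M"
  shows "matroid (restriction M A)"
proof
  show "finite (ground (restriction M A))"
    using finite_subset[OF assms finite_ground] by (simp add: restriction_def)
  show "\<exists>x\<in>J - I. insert x I \<in> indep_sets (restriction M A)"
    if "I \<in> indep_sets (restriction M A)" "J \<in> indep_sets (restriction M A)" "card I < card J" for I J
    using that augmentation[of I J] by (fastforce simp: restriction_def)
qed (use empty_indep indep_mono in \<open>auto simp: restriction_def\<close>)

text \<open>
  In a direct sum, independent sets of a summand and of its complement have an independent union, so ranks add.
\<close>

lemma decomposition_separations:
  assumes "A \<subseteq> ground M" "decomposition (restriction M A) k N"
  shows "\<exists>P\<in>separations (\<lambda>A. int (rank_of M A)) A. card P = k"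
proof -
  let ?g = "\<lambda>i. ground (N i)"
  have N: "\<And>i. i < k \<Longrightarrow> matroid (N i)" "\<And>i. i < k \<Longrightarrow> ?g i \<noteq> {}"
    and dis: "\<And>i j. i < k \<Longrightarrow> j < k \<Longrightarrow> i \<noteq> j \<Longrightarrow> ?g i \<inter> ?g j = {}"
    and sum: "restriction M A = direct_sum k N"
    using assms(2) by (auto simp: decomposition_def disjoint_family_on_def)
  have A: "A = (\<Union>i<k. ?g i)"
    using arg_cong[OF sum, of ground] by (simp add: restriction_def direct_sum_def)
  have ind: "I \<in> indep_sets M \<and> I \<subseteq> A \<longleftrightarrow> (\<exists>K. I = (\<Union>i<k. K i) \<and> (\<forall>i<k. K i \<in> indep_sets (N i)))" for I
    using arg_cong[OF sum, of indep_sets] unfolding restriction_def direct_sum_def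
    by (simp add: set_eq_iff[of "{I \<in> indep_sets M. I \<subseteq> A}"])
  have inN: "K \<subseteq> ?g i" if "i < k" "K \<in> indep_sets (N i)" for i K
    using matroid.indep_sets_subset[OF N(1)] that by blast
  have sep: "separator (\<lambda>A. int (rank_of M A)) A (?g i)" if i: "i < k" for i
  proof (rule rank_function.separatorI[OF rank_function_rank_of])
    show sub: "?g i \<subseteq> A" using i A by auto
    show "A \<subseteq> ground M" by (rule assms(1))
    obtain I where I: "I \<in> indep_sets M" "I \<subseteq> ?g i" "card I = rank_of M (?g i)"
      by (rule rank_of_attained)
    obtain J where J: "J \<in> indep_sets M" "J \<subseteq> A - ?g i" "card J = rank_of M (A - ?g i)"
      by (rule rank_of_attained)
    obtain K where K: "I = (\<Union>j<k. K j)" "\<And>j. j < k \<Longrightarrow> K j \<in> indep_sets (N j)"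
      using ind[of I] I sub by blast
    obtain L where L: "J = (\<Union>j<k. L j)" "\<And>j. j < k \<Longrightarrow> L j \<in> indep_sets (N j)"
      using ind[of J] J by blast
    have K0: "K j = {}" if "j < k" "j \<noteq> i" for j
      using dis[OF i that(1)] that inN[OF that(1) K(2)[OF that(1)]] I(2) K(1) by blast
    have L0: "L i = {}"
      using inN[OF i L(2)[OF i]] J(2) L(1) i by blast
    \<comment> \<open>Since the grounds are disjoint, \<open>I\<close> lives in summand \<open>i\<close> alone and \<open>J\<close> in the others, so the
      two families of pieces can be merged into one.\<close>
    define Q where "Q j = (if j = i then K j else L j)" for j
    have "I \<union> J = (\<Union>j<k. Q j)"
      using K0 L0 i unfolding K(1) L(1) Q_def by (fastforce split: if_splits)
    moreover have "Q j \<in> indep_sets (N j)" if "j < k" for j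
      using that K L by (simp add: Q_def)
    ultimately have "I \<union> J \<in> indep_sets M" "I \<union> J \<subseteq> A" using ind[of "I \<union> J"] by blast+
    then have "card (I \<union> J) \<le> rank_of M A" by (rule card_le_rank_of)
    moreover have "card (I \<union> J) = card I + card J"
      using I J indep_finite by (intro card_Un_disjoint) auto
    ultimately show "int (rank_of M (?g i)) + int (rank_of M (A - ?g i)) \<le> int (rank_of M A)"
      using I(3) J(3) by simp
  qed
  have "inj_on ?g {..<k}" using N(2) dis by (fastforce simp: inj_on_def)
  then have "card (?g ` {..<k}) = k" by (simp add: card_image)
  moreover have "?g ` {..<k} \<in> separations (\<lambda>A. int (rank_of M A)) A"
    using A N(2) dis sep by (fastforce simp: separations_def partition_on_def disjoint_def)
  ultimately show ?thesis by blast
qed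

text \<open>
  The summands are the restrictions to the parts. A union of independent sets in the parts is independent
  because its rank, which adds up over the separators, equals its size.
\<close>

lemma separations_decomposition:
  assumes "A \<subseteq> ground M" and P: "P \<in> separations (\<lambda>A. int (rank_of M A)) A"
  shows "\<exists>N. decomposition (restriction M A) (card P) N"
proof -
  interpret rank_function "ground M" "\<lambda>A. int (rank_of M A)" by (rule rank_function_rank_of)
  have "finite A" using assms(1) by (rule finite_sub)
  moreover have part: "\<Union>P = A" "disjoint P" "{} \<notin> P"
    and sep: "\<And>S. S \<in> P \<Longrightarrow> separator (\<lambda>A. int (rank_of M A)) A S"
    using P by (auto simp: separations_def partition_on_def)
  ultimately have "finite P" by (auto intro: finite_UnionD)
  then obtain h where h: "bij_betw h {..<card P} P"
    using ex_bij_betw_nat_finite atLeast0LessThan by metis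
  let ?k = "card P"
  have hP: "h i \<in> P" if "i < ?k" for i using h that by (auto simp: bij_betw_def)
  have hA: "h i \<subseteq> A" if "i < ?k" for i using hP[OF that] part(1) by auto
  have dis: "h i \<inter> h j = {}" if "i < ?k" "j < ?k" "i \<noteq> j" for i j
  proof -
    have "h i \<noteq> h j" using h that by (auto simp: bij_betw_def inj_on_def)
    then show ?thesis using part(2) hP[OF that(1)] hP[OF that(2)] by (auto simp: disjoint_def)
  qed
  have UA: "(\<Union>i<?k. h i) = A"
    using h part(1) unfolding bij_betw_def by metis
  have glue: "(\<Union>i<n. K i) \<in> indep_sets M"
    if "n \<le> ?k" and K: "\<And>i. i < ?k \<Longrightarrow> K i \<in> indep_sets M \<and> K i \<subseteq> h i" for n K
    using that(1)
  proof (induction n)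
    case (Suc n)
    let ?J = "\<Union>i<n. K i" and ?J' = "\<Union>i<Suc n. K i"
    have n: "n < ?k" and J: "?J \<in> indep_sets M" using Suc by auto
    have "K i \<subseteq> A" if "i < Suc n" for i
      using that(1) n K[of i] hA[of i] by auto
    then have sub: "?J' \<subseteq> A" by auto
    have "K i \<inter> h n = {}" if "i < n" for i
      using that(1) n K[of i] dis[of i n] by auto
    then have out: "?J \<inter> h n = {}" by auto
    have J': "?J' \<inter> h n = K n" "?J' - h n = ?J" "?J' = ?J \<union> K n"
      using out K[OF n] by (auto simp: lessThan_Suc)
    have fin: "finite ?J" "finite (K n)" using J K[OF n] indep_finite by auto
    have "int (rank_of M ?J') = int (rank_of M (K n)) + int (rank_of M ?J)"
      using separator_split[OF sep[OF hP[OF n]] assms(1) sub] unfolding J'(1,2) .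
    also have "\<dots> = int (card (K n)) + int (card ?J)"
      using J K[OF n] indep_iff_rank_of[OF fin(1)] indep_iff_rank_of[OF fin(2)] by simp
    also have "\<dots> = int (card ?J')"
      unfolding J'(3) using fin out K[OF n] by (subst card_Un_disjoint) auto
    finally show ?case using fin J'(3) indep_iff_rank_of[of ?J'] by simp
  qed (simp add: empty_indep)
  define N where "N i = restriction M (h i)" for i
  have "{I \<in> indep_sets M. I \<subseteq> A} = {(\<Union>i<?k. K i) | K. \<forall>i<?k. K i \<in> indep_sets (N i)}"
  proof (intro equalityI subsetI)
    fix I assume "I \<in> {I \<in> indep_sets M. I \<subseteq> A}"
    then have I: "I \<in> indep_sets M" "I \<subseteq> A" by auto
    have "I = (\<Union>i<?k. I \<inter> h i)" using I(2) UA by blast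
    moreover have "\<forall>i<?k. I \<inter> h i \<in> indep_sets (N i)"
      using indep_mono[OF I(1)] by (auto simp: N_def restriction_def)
    ultimately show "I \<in> {(\<Union>i<?k. K i) | K. \<forall>i<?k. K i \<in> indep_sets (N i)}" by blast
  next
    fix I assume "I \<in> {(\<Union>i<?k. K i) | K. \<forall>i<?k. K i \<in> indep_sets (N i)}"
    then obtain K where K: "I = (\<Union>i<?k. K i)" "\<And>i. i < ?k \<Longrightarrow> K i \<in> indep_sets M \<and> K i \<subseteq> h i"
      by (auto simp: N_def restriction_def)
    then have "I \<in> indep_sets M" using glue[of ?k K] by simp
    moreover have "I \<subseteq> A" unfolding K(1)
    proof (rule UN_least)
      fix i assume "i \<in> {..<?k}"
      then show "K i \<subseteq> A" using K(2)[of i] hA[of i] by auto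
    qed
    ultimately show "I \<in> {I \<in> indep_sets M. I \<subseteq> A}" by simp
  qed
  then have "restriction M A = direct_sum ?k N"
    using UA by (simp add: restriction_def direct_sum_def N_def)
  moreover have "matroid (N i)" if "i < ?k" for i
    unfolding N_def using hA[OF that] assms(1) by (intro matroid_restriction) blast
  moreover have "ground (N i) \<noteq> {}" if "i < ?k" for i
    using hP[OF that] part(3) by (auto simp: N_def restriction_def)
  moreover have "disjoint_family_on (\<lambda>i. ground (N i)) {..<?k}"
    using dis by (auto simp: disjoint_family_on_def N_def restriction_def)
  ultimately have "decomposition (restriction M A) ?k N" by (simp add: decomposition_def)
  then show ?thesis by blast
qed

theorem num_components_restriction:
  assumes "A \<subseteq> ground M"
  shows "num_components (restriction M A) = ncomp (\<lambda>A. int (rank_of M A)) A"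
proof -
  have "{k. \<exists>N. decomposition (restriction M A) k N}
      = card ` separations (\<lambda>A. int (rank_of M A)) A"
    using decomposition_separations[OF assms] separations_decomposition[OF assms] by blast
  then show ?thesis by (simp add: num_components_def ncomp_def)
qed

lemma basis_iff_card: "basis M B \<longleftrightarrow> B \<in> indep_sets M \<and> card B = rk M"
proof
  assume B: "basis M B"
  then have "B \<in> indep_sets M" "B \<subseteq> ground M"
    using indep_sets_subset by (auto simp: basis_def)
  moreover from this obtain I where "I \<in> indep_sets M" "B \<subseteq> I" "card I = rk M"
    unfolding rk_def by (rule indep_extend)
  ultimately show "B \<in> indep_sets M \<and> card B = rk M" using B by (auto simp: basis_def)
next
  assume B: "B \<in> indep_sets M \<and> card B = rk M"
  have "I = B" if I: "I \<in> indep_sets M" "B \<subseteq> I" for I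
  proof -
    have "card I \<le> card B"
      using B card_le_rank_of[OF I(1)] indep_sets_subset I(1) unfolding rk_def by auto
    then show ?thesis using card_seteq[OF indep_finite[OF I(1)] I(2)] by simp
  qed
  then show "basis M B" using B by (simp add: basis_def)
qed

text \<open>
  An independent set of the dual inside \<open>A\<close> avoids a basis \<open>B\<close>, hence has size at most \<open>|A - B|\<close>. This is
  largest for a basis meeting \<open>A\<close> as little as possible, that is, one that extends a maximal
  independent subset of the complement of \<open>A\<close>.
\<close>

theorem rank_of_dual:
  assumes "A \<subseteq> ground M"
  shows "int (rank_of (dual M) A) = int (card A) + int (rank_of M (ground M - A)) - int (rk M)"
proof -
  let ?E = "ground M"
  have finA: "finite A" using assms finite_ground finite_subset by blast
  have le: "int (card I) \<le> int (card A) + int (rank_of M (?E - A)) - int (rk M)"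
    if "basis M B" "I \<subseteq> ?E - B" "I \<subseteq> A" for I B
  proof -
    have B: "B \<in> indep_sets M" "card B = rk M" using that(1) basis_iff_card by auto
    have BE: "B \<subseteq> ?E" using B(1) indep_sets_subset by auto
    have "card (B - A) \<le> rank_of M (?E - A)"
      using indep_mono[OF B(1)] BE by (intro card_le_rank_of) auto
    moreover have "card B = card (B \<inter> A) + card (B - A)"
      using card_Int_Diff[OF indep_finite[OF B(1)]] .
    moreover have "card (I \<union> (B \<inter> A)) \<le> card A" using that finA by (intro card_mono) auto
    moreover have "card (I \<union> (B \<inter> A)) = card I + card (B \<inter> A)"
      using that finA by (intro card_Un_disjoint) (auto intro: finite_subset)
    ultimately show ?thesis using B(2) by simp
  qed
  obtain J where J: "J \<in> indep_sets M" "J \<subseteq> ?E - A" "card J = rank_of M (?E - A)"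
    by (rule rank_of_attained)
  then have "J \<subseteq> ?E" by auto
  then obtain B where B: "B \<in> indep_sets M" "J \<subseteq> B" "B \<subseteq> ?E" "card B = rk M"
    unfolding rk_def by (rule indep_extend[OF J(1)])
  then have bB: "basis M B" using basis_iff_card by blast
  have "card J \<le> card (B - A)"
    using J(2) B(2) indep_finite[OF B(1)] by (intro card_mono) auto
  moreover have "card B = card (A \<inter> B) + card (B - A)"
    using card_Int_Diff[OF indep_finite[OF B(1)], of A] by (simp add: Int_commute)
  moreover have "card A = card (A \<inter> B) + card (A - B)"
    by (rule card_Int_Diff[OF finA])
  ultimately have ge: "int (card A) + int (rank_of M (?E - A)) - int (rk M) \<le> int (card (A - B))"
    using J(3) B(4) by simp
  have AB: "A - B \<in> {I \<in> indep_sets (dual M). I \<subseteq> A}"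
    using bB assms by (auto simp: dual_def)
  have "rank_of (dual M) A = card (A - B)"
    unfolding rank_of_def
  proof (rule Max_eqI)
    have "{I \<in> indep_sets (dual M). I \<subseteq> A} \<subseteq> Pow A" by auto
    then show "finite (card ` {I \<in> indep_sets (dual M). I \<subseteq> A})"
      using finA by (meson finite_Pow_iff finite_imageI finite_subset)
    show "card (A - B) \<in> card ` {I \<in> indep_sets (dual M). I \<subseteq> A}" using AB by blast
    fix n assume "n \<in> card ` {I \<in> indep_sets (dual M). I \<subseteq> A}"
    then obtain I B' where "n = card I" "basis M B'" "I \<subseteq> ?E - B'" "I \<subseteq> A"
      by (auto simp: dual_def)
    then show "n \<le> card (A - B)" using le[of B' I] ge by simp
  qed
  moreover have "int (card (A - B)) \<le> int (card A) + int (rank_of M (?E - A)) - int (rk M)"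
    using le[OF bB, of "A - B"] assms by auto
  ultimately show ?thesis using ge by simp
qed

end


section \<open>Cycle matroids\<close>

text \<open>
  Acyclicity as "no edge has its ends connected by the other edges", which speaks of edges and ends only
  and is therefore immediately compatible with the rank and with renaming edges.
\<close>

definition forest :: "('v, 'e) pre_multigraph \<Rightarrow> 'e set \<Rightarrow> bool" where
  "forest G F \<longleftrightarrow>
    (\<forall>x\<in>F. \<forall>a b. ends G x = {a, b} \<longrightarrow> component G (F - {x}) a \<noteq> component G (F - {x}) b)"

lemma forest_pullback:
  assumes "inj_on f F" "\<And>x. x \<in> F \<Longrightarrow> ends H x = ends G (f x)"
  shows "forest H F \<longleftrightarrow> forest G (f ` F)"
proof -
  have "component H (F - {x}) v = component G (f ` F - {f x}) v" if "x \<in> F" for x v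
  proof -
    have "f ` F - {f x} = f ` (F - {x})" using inj_on_image_set_diff[OF assms(1), of F "{x}"] that by simp
    then have "adj H (F - {x}) = adj G (f ` F - {f x})"
      using assms(2) by (auto simp: adj_def)
    then show ?thesis by (simp add: component_def)
  qed
  then show ?thesis using assms(2) by (auto simp: forest_def)
qed

lemma simple_path:
  assumes "(a, b) \<in> (adj G F)\<^sup>*"
  shows "\<exists>vs es. length vs = Suc (length es) \<and> distinct vs \<and> vs ! 0 = a \<and> vs ! length es = b \<and>
    (\<forall>i < length es. es ! i \<in> F \<and> ends G (es ! i) = {vs ! i, vs ! Suc i})"
  using assms
proof (induction rule: rtrancl_induct)
  case base
  show ?case by (intro exI[of _ "[a]"] exI[of _ "[]"]) simp
next
  case (step b c)
  then obtain vs es where p: "length vs = Suc (length es)" "distinct vs" "vs ! 0 = a" "vs ! length es = b"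
    "\<And>i. i < length es \<Longrightarrow> es ! i \<in> F \<and> ends G (es ! i) = {vs ! i, vs ! Suc i}" by blast
  obtain x where x: "x \<in> F" "ends G x = {b, c}" using step.hyps(2) by (auto simp: adj_def)
  show ?case
  proof (cases "c \<in> set vs")
    case True
    \<comment> \<open>The path already visits \<open>c\<close>: cut it off there.\<close>
    then obtain j where j: "j \<le> length es" "c = vs ! j"
      using p(1) by (auto simp: in_set_conv_nth less_Suc_eq_le)
    then show ?thesis
      using p by (intro exI[of _ "take (Suc j) vs"] exI[of _ "take j es"]) auto
  next
    case False
    then show ?thesis
      using p x by (intro exI[of _ "vs @ [c]"] exI[of _ "es @ [x]"])
        (auto simp: nth_append less_Suc_eq)
  qed
qed

lemma cycle_closes_path:
  assumes "is_cycle G vs es" "set es \<subseteq> F"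
  shows "\<exists>x\<in>F. \<exists>a b. ends G x = {a, b} \<and> component G (F - {x}) a = component G (F - {x}) b"
proof -
  define n where "n = length es - 1"
  have c: "es \<noteq> []" "distinct es" and len: "length es = Suc n"
    and e: "\<And>i. i < length es \<Longrightarrow> ends G (es ! i) = {vs ! i, vs ! (Suc i mod length es)}"
    using assms(1) by (auto simp: is_cycle_def n_def)
  let ?x = "es ! n"
  have path: "component G (F - {?x}) (vs ! 0) = component G (F - {?x}) (vs ! i)" if "i \<le> n" for i
    using that
  proof (induction i)
    case (Suc i)
    have "es ! i \<noteq> ?x" using Suc.prems c(2) len by (simp add: nth_eq_iff_index_eq)
    moreover have "es ! i \<in> F" using assms(2) Suc.prems len by (simp add: subset_iff)
    ultimately have "component G (F - {?x}) (vs ! i) = component G (F - {?x}) (vs ! Suc i)"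
      using e[of i] Suc.prems len by (intro component_edge[of "es ! i"]) auto
    then show ?case using Suc by simp
  qed simp
  have "component G (F - {?x}) (vs ! n) = component G (F - {?x}) (vs ! 0)"
    using path[of n] by simp
  moreover have "ends G ?x = {vs ! n, vs ! 0}" using e[of n] len by simp
  moreover have "?x \<in> F" using assms(2) len by (simp add: subset_iff)
  ultimately show ?thesis by blast
qed

lemma closed_path_cycle:
  assumes "x \<in> F" "F \<subseteq> edges G" "ends G x = {a, b}"
    and "component G (F - {x}) a = component G (F - {x}) b"
  shows "\<exists>vs es. is_cycle G vs es \<and> set es \<subseteq> F"
proof -
  obtain vs es where p: "length vs = Suc (length es)" "distinct vs" "vs ! 0 = a" "vs ! length es = b"
    "\<And>i. i < length es \<Longrightarrow> es ! i \<in> F - {x} \<and> ends G (es ! i) = {vs ! i, vs ! Suc i}"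
    using simple_path assms(4)[unfolded component_eq_iff] by metis
  have es: "set es \<subseteq> F - {x}"
  proof
    fix y assume "y \<in> set es"
    then obtain i where "i < length es" "y = es ! i" by (auto simp: in_set_conv_nth)
    then show "y \<in> F - {x}" using p(5)[of i] by simp
  qed
  have "distinct es"
    unfolding distinct_conv_nth
  proof (intro allI impI)
    fix i j assume ij: "i < length es" "j < length es" "i \<noteq> j"
    have "{vs ! i, vs ! Suc i} \<noteq> {vs ! j, vs ! Suc j}"
      using ij p(1,2) by (auto simp: doubleton_eq_iff nth_eq_iff_index_eq)
    then show "es ! i \<noteq> es ! j" using p(5)[of i] p(5)[of j] ij by metis
  qed
  moreover have "ends G ((es @ [x]) ! i) = {vs ! i, vs ! (Suc i mod length (es @ [x]))}"
    if "i < length (es @ [x])" for i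
    using that p(1,3,4) p(5)[of i] assms(3) by (cases "i = length es") (auto simp: nth_append)
  ultimately have "is_cycle G vs (es @ [x])"
    using es p(1,2) assms(1,2) by (auto simp: is_cycle_def)
  moreover have "set (es @ [x]) \<subseteq> F" using es assms(1) by auto
  ultimately show ?thesis by blast
qed

lemma indep_cycle_matroid_iff:
  "F \<in> indep_sets (cycle_matroid G) \<longleftrightarrow> F \<subseteq> edges G \<and> forest G F"
proof -
  have "(\<exists>vs es. is_cycle G vs es \<and> set es \<subseteq> F) \<longleftrightarrow>
      (\<exists>x\<in>F. \<exists>a b. ends G x = {a, b} \<and> component G (F - {x}) a = component G (F - {x}) b)"
    if "F \<subseteq> edges G"
    using cycle_closes_path[of G _ _ F] closed_path_cycle[OF _ that] by (intro iffI) (elim exE conjE bexE, blast)+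
  then show ?thesis by (simp add: cycle_matroid_def forest_def) blast
qed

lemma forest_subset:
  assumes "forest G F" "F' \<subseteq> F"
  shows "forest G F'"
  unfolding forest_def
proof (intro ballI allI impI)
  fix x a b assume x: "x \<in> F'" "ends G x = {a, b}"
  then have "component G (F - {x}) a \<noteq> component G (F - {x}) b"
    using assms by (auto simp: forest_def)
  moreover have "component G (F' - {x}) a \<subseteq> component G (F - {x}) a"
    using assms(2) by (intro component_mono) auto
  ultimately show "component G (F' - {x}) a \<noteq> component G (F' - {x}) b"
    by (auto simp: component_eq_iff_mem)
qed

context multigraph
begin

lemma forest_iff_grank:
  assumes "F \<subseteq> edges G"
  shows "forest G F \<longleftrightarrow> grank G F = int (card F)"
proof
  show "grank G F = int (card F)" if "forest G F"
    using gr.finite_sub[OF assms] assms that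
  proof (induction F)
    case empty
    then show ?case by (simp add: grank_empty)
  next
    case (insert x F)
    obtain a b where ab: "ends G x = {a, b}" using ends_pair[of x] insert.prems(1) by blast
    have "component G (insert x F - {x}) a \<noteq> component G (insert x F - {x}) b"
      using insert.prems(2) ab by (auto simp: forest_def)
    then have "component G F a \<noteq> component G F b" using insert.hyps(2) by simp
    moreover have "forest G F" using insert.prems(2) by (rule forest_subset) auto
    ultimately show ?case using grank_insert[OF insert.prems(1) ab] insert by simp
  qed
next
  assume eq: "grank G F = int (card F)"
  show "forest G F"
    unfolding forest_def
  proof (intro ballI allI impI notI)
    fix x a b assume x: "x \<in> F" "ends G x = {a, b}"
      and *: "component G (F - {x}) a = component G (F - {x}) b"
    have ins: "insert x (F - {x}) = F" using x(1) by auto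
    then have "grank G F = grank G (F - {x})"
      using grank_insert[of x "F - {x}" a b] x(2) * assms by simp
    also have "\<dots> \<le> int (card (F - {x}))" using assms by (intro gr.r_le_card) auto
    also have "card (F - {x}) < card F"
      using x(1) gr.finite_sub[OF assms] by (intro psubset_card_mono) auto
    finally show False using eq by simp
  qed
qed

end

text \<open>
  A maximal independent \<open>I \<subseteq> A\<close> has \<open>r (I \<union> {x}) = r I\<close> for every \<open>x \<in> A\<close>, so \<open>r I = r A\<close> by submodularity.
\<close>

lemma (in rank_function) rank_of_eq:
  assumes indep: "\<And>I. I \<in> indep_sets Q \<longleftrightarrow> I \<subseteq> E \<and> r I = int (card I)" and "A \<subseteq> E"
  shows "int (rank_of Q A) = r A"
proof -
  have le: "int (card I) \<le> r A" if "I \<in> indep_sets Q" "I \<subseteq> A" for I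
    using that indep r_mono[OF that(2) assms(2)] by simp
  have fin: "finite {I \<in> indep_sets Q. I \<subseteq> A}"
    by (rule finite_subset[of _ "Pow A"]) (use finite_sub[OF assms(2)] in auto)
  have "{I \<in> indep_sets Q. I \<subseteq> A} \<noteq> {}" using indep[of "{}"] r_empty by auto
  then have "rank_of Q A \<in> card ` {I \<in> indep_sets Q. I \<subseteq> A}"
    unfolding rank_of_def using fin by (intro Max_in) auto
  then obtain I where I: "I \<in> indep_sets Q" "I \<subseteq> A" "card I = rank_of Q A" by auto
  have rI: "r I = int (card I)" using I(1) indep by simp
  have step: "r (insert x I) = r I" if x: "x \<in> A" for x
  proof (rule ccontr)
    assume *: "r (insert x I) \<noteq> r I"
    have IE: "I \<subseteq> E" "x \<in> E" using I(2) x assms(2) by auto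
    have "r (insert x I) = r I + 1" using * r_insert_ge[OF IE] r_insert_le[OF IE] by simp
    moreover have "x \<notin> I" using * by (auto simp: insert_absorb)
    then have card: "card (insert x I) = card I + 1" using finite_sub[OF IE(1)] by simp
    ultimately have "insert x I \<in> indep_sets Q" using indep IE rI by simp
    then have "card (insert x I) \<le> rank_of Q A"
      unfolding rank_of_def using fin x I(2) by (intro Max_ge) auto
    then show False using card I(3) by simp
  qed
  have "r (I \<union> Z) = r I" if "Z \<subseteq> A" for Z
    using finite_subset[OF that finite_sub[OF assms(2)]] that
  proof (induction Z)
    case (insert x Z)
    let ?U = "I \<union> Z"
    have sub: "?U \<subseteq> E" "insert x I \<subseteq> E" "x \<in> E" using insert.prems I(2) assms(2) by auto
    have "r (?U \<union> insert x I) + r (?U \<inter> insert x I) \<le> r ?U + r (insert x I)"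
      by (rule submodular[OF sub(1,2)])
    moreover have "r I \<le> r (?U \<inter> insert x I)" using sub by (intro r_mono) auto
    moreover have "?U \<union> insert x I = insert x ?U" by auto
    moreover have "r ?U \<le> r (insert x ?U)" by (rule r_insert_ge[OF sub(1,3)])
    ultimately show ?case using insert step[of x] by simp
  qed simp
  from this[OF order_refl] have "r A = r I" using I(2) by (simp add: Un_absorb1)
  then show ?thesis using rI I(3) by simp
qed

text \<open>
  The isomorphism is absorbed by relabelling the edges with the elements of the ground set. Isolated vertices are
  dropped, so that for every vertex \<open>v\<close> some edge at \<open>v\<close> makes the alternating sum of \<open>r(A - \<delta>(v))\<close> vanish.
\<close>

lemma graphic_obtains_graph:
  assumes "graphic Q" "indep_sets Q \<subseteq> Pow (ground Q)"
  obtains H :: "(nat, 'a) pre_multigraph" where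
    "multigraph H" "edges H = ground Q" "verts H = \<Union>(ends H ` edges H)"
    "\<And>A. A \<subseteq> ground Q \<Longrightarrow> int (rank_of Q A) = grank H A"
proof -
  obtain G :: "(nat, nat) pre_multigraph" and f where G: "multigraph G"
    and f: "bij_betw f (ground Q) (edges G)"
    and ind: "\<And>I. I \<subseteq> ground Q \<Longrightarrow> I \<in> indep_sets Q \<longleftrightarrow> f ` I \<in> indep_sets (cycle_matroid G)"
    using assms(1) by (auto simp: graphic_def matroid_iso_def cycle_matroid_def)
  define H where "H = \<lparr>verts = \<Union>(ends G ` edges G), edges = ground Q, ends = ends G \<circ> f\<rparr>"
  have fE: "f ` ground Q = edges G" "inj_on f (ground Q)" using f by (auto simp: bij_betw_def)
  have "\<Union>(ends G ` edges G) \<subseteq> verts G" using multigraph.ends_subset[OF G] by auto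
  then have "finite (verts H)" using multigraph.finite_verts[OF G] by (simp add: H_def finite_subset)
  moreover have "finite (edges H)"
    using multigraph.finite_edges[OF G] f by (simp add: H_def bij_betw_finite)
  ultimately have H: "multigraph H"
    using multigraph.card_ends[OF G] fE by unfold_locales (auto simp: H_def)
  then interpret multigraph H .
  have "I \<in> indep_sets Q \<longleftrightarrow> I \<subseteq> edges H \<and> grank H I = int (card I)" for I
  proof (cases "I \<subseteq> ground Q")
    case True
    have "I \<in> indep_sets Q \<longleftrightarrow> forest G (f ` I)"
      using ind[OF True] indep_cycle_matroid_iff fE(1) True by blast
    also have "\<dots> \<longleftrightarrow> forest H I"
      using inj_on_subset[OF fE(2) True] by (intro forest_pullback[symmetric]) (auto simp: H_def)
    also have "\<dots> \<longleftrightarrow> grank H I = int (card I)"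
      using True by (intro forest_iff_grank) (simp add: H_def)
    finally show ?thesis using True by (simp add: H_def)
  next
    case False
    then show ?thesis using assms(2) by (auto simp: H_def)
  qed
  then have "int (rank_of Q A) = grank H A" if "A \<subseteq> ground Q" for A
    using that by (intro gr.rank_of_eq) (auto simp: H_def)
  moreover have "verts H = \<Union>(ends H ` edges H)"
    by (simp add: H_def image_comp flip: fE(1))
  ultimately show ?thesis using that[OF H] by (simp add: H_def)
qed


section \<open>The formula\<close>

lemma (in matroid) sum_num_components_graphic:
  assumes "graphic M" "card (ground M) \<ge> 2"
  shows "(\<Sum>A\<in>Pow (ground M). (-1) ^ card A * int (num_components (restriction M A)))
    = int (rk M) * (\<Sum>A\<in>Pow (ground M). (-1) ^ card A * int (rank_of M A))"
proof -
  obtain H :: "(nat, 'a) pre_multigraph" where H: "multigraph H"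
    and E: "edges H = ground M" and V: "verts H = \<Union>(ends H ` edges H)"
    and rank: "\<And>A. A \<subseteq> ground M \<Longrightarrow> int (rank_of M A) = grank H A"
    using graphic_obtains_graph[OF assms(1) indep_sets_subset] by blast
  interpret multigraph H by (rule H)
  have comp: "num_components (restriction M A) = ncomp (grank H) A" if "A \<subseteq> ground M" for A
  proof -
    have "separator (\<lambda>A. int (rank_of M A)) A S \<longleftrightarrow> separator (grank H) A S" if "S \<subseteq> A" for S
    proof -
      have "S \<subseteq> ground M" "A - S \<subseteq> ground M" using that \<open>A \<subseteq> ground M\<close> by auto
      then show ?thesis using rank \<open>A \<subseteq> ground M\<close> by (simp add: separator_def)
    qed
    then show ?thesis unfolding num_components_restriction[OF \<open>A \<subseteq> ground M\<close>] by (rule ncomp_cong)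
  qed
  have "(\<Sum>A\<in>Pow (ground M). (-1) ^ card A * int (num_components (restriction M A)))
      = (\<Sum>A\<in>Pow (edges H). (-1) ^ card A * int (ncomp (grank H) A))"
    unfolding E using comp by (intro sum.cong) auto
  also have "\<dots> = grank H (edges H) * (\<Sum>A\<in>Pow (edges H). (-1) ^ card A * grank H A)"
    using assms(2) V by (intro alternating_sum_ncomp) (simp_all add: E)
  also have "grank H (edges H) = int (rk M)" using rank[of "ground M"] by (simp add: E rk_def)
  also have "(\<Sum>A\<in>Pow (edges H). (-1) ^ card A * grank H A)
      = (\<Sum>A\<in>Pow (ground M). (-1) ^ card A * int (rank_of M A))"
    unfolding E using rank by (intro sum.cong) auto
  finally show ?thesis .
qed

text \<open>
  By the rank formula for the dual, \<open>S\<close> is a separator of \<open>M\<close> restricted to \<open>A\<close> iff it is one of the dual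
  contracted by \<open>E - A\<close>, so both have equally many components. Replacing \<open>A\<close> by its complement multiplies alternating sums
  by \<open>(-1)^|E|\<close>, the same sign for the components and for the rank.
\<close>

lemma (in matroid) sum_num_components_cographic:
  assumes "cographic M" "card (ground M) \<ge> 2"
  shows "(\<Sum>A\<in>Pow (ground M). (-1) ^ card A * int (num_components (restriction M A)))
    = int (rk M) * (\<Sum>A\<in>Pow (ground M). (-1) ^ card A * int (rank_of M A))"
proof -
  let ?E = "ground M"
  have "graphic (dual M)" "indep_sets (dual M) \<subseteq> Pow (ground (dual M))"
    using assms(1) by (auto simp: cographic_def dual_def)
  then obtain H :: "(nat, 'a) pre_multigraph" where H: "multigraph H"
    and E': "edges H = ground (dual M)"
    and rank': "\<And>A. A \<subseteq> ground (dual M) \<Longrightarrow> int (rank_of (dual M) A) = grank H A"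
    using graphic_obtains_graph by metis
  interpret multigraph H by (rule H)
  have E: "edges H = ?E" using E' by (simp add: dual_def)
  have q: "grank H A = int (card A) + int (rank_of M (?E - A)) - int (rk M)" if "A \<subseteq> ?E" for A
    using rank'[of A] rank_of_dual[OF that] that by (simp add: dual_def)
  have qE: "grank H ?E = int (card ?E) - int (rk M)"
    using q[of ?E] rank_of_le_card[of "{}"] by simp
  have rank: "int (rank_of M A) = int (card A) + grank H (?E - A) - grank H ?E" if "A \<subseteq> ?E" for A
  proof -
    have "?E - (?E - A) = A" using that by auto
    moreover have "card (?E - A) = card ?E - card A" "card A \<le> card ?E"
      using that finite_ground by (auto intro: card_Diff_subset card_mono finite_subset)
    ultimately show ?thesis using q[of "?E - A"] qE by (simp add: of_nat_diff)
  qed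
  have comp: "num_components (restriction M A)
      = ncomp (\<lambda>X. grank H (X \<union> (?E - A)) - grank H (?E - A)) (?E - (?E - A))" if A: "A \<subseteq> ?E" for A
  proof -
    have EA: "?E - (?E - A) = A" using A by auto
    have "separator (\<lambda>A. int (rank_of M A)) A S
        \<longleftrightarrow> separator (\<lambda>X. grank H (X \<union> (?E - A)) - grank H (?E - A)) A S" if S: "S \<subseteq> A" for S
    proof -
      have "S \<subseteq> ?E" "A - S \<subseteq> ?E" using S A by auto
      moreover have "?E - S = (A - S) \<union> (?E - A)" "?E - (A - S) = S \<union> (?E - A)" "A \<union> (?E - A) = ?E"
        using S A by auto
      moreover have "card S + card (A - S) = card A"
        using S finite_subset[OF A finite_ground]
        by (metis card_Diff_subset card_mono finite_subset le_add_diff_inverse)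
      then have "int (card S) + int (card (A - S)) = int (card A)" by simp
      ultimately show ?thesis using S rank[of S] rank[of "A - S"] rank[OF A] by (auto simp: separator_def)
    qed
    then show ?thesis
      unfolding num_components_restriction[OF A] EA by (rule ncomp_cong)
  qed
  have "(\<Sum>A\<in>Pow ?E. (-1) ^ card A * int (num_components (restriction M A)))
      = (\<Sum>A\<in>Pow ?E. (-1) ^ card A *
          int (ncomp (\<lambda>X. grank H (X \<union> (?E - A)) - grank H (?E - A)) (?E - (?E - A))))"
    using comp by (intro sum.cong) auto
  also have "\<dots> = (-1) ^ card ?E *
      (\<Sum>B\<in>Pow ?E. (-1) ^ card B * int (ncomp (\<lambda>X. grank H (X \<union> B) - grank H B) (?E - B)))"
    by (rule alternating_sum_complement[OF finite_ground])
  also have "(\<Sum>B\<in>Pow ?E. (-1) ^ card B * int (ncomp (\<lambda>X. grank H (X \<union> B) - grank H B) (?E - B)))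
      = int (rk M) * (\<Sum>B\<in>Pow ?E. (-1) ^ card B * grank H B)"
    using alternating_sum_ncomp_contract assms(2) qE by (simp add: E)
  finally have lhs: "(\<Sum>A\<in>Pow ?E. (-1) ^ card A * int (num_components (restriction M A)))
      = int (rk M) * ((-1) ^ card ?E * (\<Sum>B\<in>Pow ?E. (-1) ^ card B * grank H B))"
    by (simp only: mult.left_commute)
  have "(\<Sum>A\<in>Pow ?E. (-1) ^ card A * int (rank_of M A))
      = (\<Sum>A\<in>Pow ?E. (-1) ^ card A * (\<Sum>x\<in>A. 1) + (-1) ^ card A * grank H (?E - A)
          - (-1) ^ card A * grank H ?E)"
    by (rule sum.cong[OF refl]) (simp add: rank ring_distribs)
  also have "\<dots> = (\<Sum>A\<in>Pow ?E. (-1) ^ card A * (\<Sum>x\<in>A. 1))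
      + (\<Sum>A\<in>Pow ?E. (-1) ^ card A * grank H (?E - A)) - (\<Sum>A\<in>Pow ?E. (-1) ^ card A * grank H ?E)"
    by (simp only: sum.distrib sum_subtractf)
  also have "(\<Sum>A\<in>Pow ?E. (-1) ^ card A * (\<Sum>x\<in>A. (1 :: int))) = 0"
    by (rule alternating_sum_additive[OF finite_ground assms(2)])
  also have "(\<Sum>A\<in>Pow ?E. (-1) ^ card A * grank H ?E) = 0"
    using finite_ground assms(2) by (intro alternating_sum_const) auto
  also have "(\<Sum>A\<in>Pow ?E. (-1) ^ card A * grank H (?E - A))
      = (-1) ^ card ?E * (\<Sum>B\<in>Pow ?E. (-1) ^ card B * grank H B)"
    by (rule alternating_sum_complement[OF finite_ground])
  finally show ?thesis using lhs by simp
qed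

theorem theorem1p1:
  fixes M :: "'a pre_matroid"
  assumes "matroid M"
    and "graphic M \<or> cographic M"
    and "card (ground M) \<ge> 2"
  shows "crapo_beta M * int (rk M) =
    (-1) ^ rk M * (\<Sum>A \<in> Pow (ground M). (-1) ^ card A * int (num_components (restriction M A)))"
proof -
  have "(\<Sum>A\<in>Pow (ground M). (-1) ^ card A * int (num_components (restriction M A)))
      = int (rk M) * (\<Sum>A\<in>Pow (ground M). (-1) ^ card A * int (rank_of M A))"
    using assms(2) matroid.sum_num_components_graphic[OF assms(1) _ assms(3)]
      matroid.sum_num_components_cographic[OF assms(1) _ assms(3)] by blast
  then show ?thesis by (simp add: crapo_beta_def mult.assoc mult.commute)
qed

end
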